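(* Let $S$ be a discrete group. If $\phi\colon \mathscr{X}\rightarrow \mathscr{Y}$ is an extension of minimal $S$-flows with phase spaces $X$ and $Y$, then $\phi_*\colon\mathcal{M}^1(X)\to\mathcal{M}^1(Y)$ is semi-open.
   Context: Let $S$ be a discrete group with identity $e$. An $S$-flow $\mathscr{X}$ is a compact Hausdorff space $X$ with a map $S\times X\to X$, $(t,x)\mapsto tx$, such that $ex=x$, $(st)x=s(tx)$, and $x\mapsto tx$ is continuous for each $t\in S$. It is minimal if $\overline{Sx}=X$ for all $x\in X$. An extension $\phi\colon\mathscr{X}\to\mathscr{Y}$ of $S$-flows is a continuous onto map $\phi\colon X\to Y$ with $\phi(tx)=t\phi(x)$ for all $t\in S$, $x\in X$. A continuous onto map $g\colon A\to B$ is semi-open if $\mathrm{int}_B\, g[U]\neq\emptyset$ for every nonempty open $U\subseteq A$. For compact Hausdorff $X$, $\mathcal{M}^1(X)$ is the space of regular Borel probability measures on $X$ with the weak* topology, and $\phi_*(\mu)=\mu\circ\phi^{-1}$. *)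

theory Defs
  imports "HOL-Probability.Probability" "HOL-Algebra.Group"
begin

(* No topology is put on S: for a discrete group, the only continuity
   required of the action is that of each translation. *)
locale flow = group S for S (structure) +
  fixes X :: "'x topology" and act :: "'s \<Rightarrow> 'x \<Rightarrow> 'x"
  assumes compact: "compact_space X"
    and Hausdorff: "Hausdorff_space X"
    and act_one: "x \<in> topspace X \<Longrightarrow> act \<one> x = x"
    and act_mult: "\<lbrakk>s \<in> carrier S; t \<in> carrier S; x \<in> topspace X\<rbrakk>
          \<Longrightarrow> act (s \<otimes> t) x = act s (act t x)"
    and continuous_act: "t \<in> carrier S \<Longrightarrow> continuous_map X X (act t)"

locale minimal_flow = flow +
  assumes dense_orbit:
    "x \<in> topspace X \<Longrightarrow> X closure_of ((\<lambda>t. act t x) ` carrier S) = topspace X"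

locale flow_extension = X: flow S X actX + Y: flow S Y actY
  for S (structure) and X :: "'x topology" and actX
    and Y :: "'y topology" and actY +
  fixes \<phi> :: "'x \<Rightarrow> 'y"
  assumes continuous: "continuous_map X Y \<phi>"
    and onto: "\<phi> ` topspace X = topspace Y"
    and equivariant: "\<lbrakk>t \<in> carrier S; x \<in> topspace X\<rbrakk>
          \<Longrightarrow> \<phi> (actX t x) = actY t (\<phi> x)"

definition semi_open_map :: "'a topology \<Rightarrow> 'b topology \<Rightarrow> ('a \<Rightarrow> 'b) \<Rightarrow> bool" where
  "semi_open_map A B g \<longleftrightarrow>
     continuous_map A B g \<and> g ` topspace A = topspace B \<and>
     (\<forall>U. openin A U \<and> U \<noteq> {} \<longrightarrow> B interior_of (g ` U) \<noteq> {})"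

definition borel_of :: "'a topology \<Rightarrow> 'a measure" where
  "borel_of X = sigma (topspace X) {U. openin X U}"

definition regular_prob_measures :: "'a topology \<Rightarrow> 'a measure set" where
  "regular_prob_measures X =
     {\<mu>. prob_space \<mu> \<and> sets \<mu> = sets (borel_of X) \<and>
         (\<forall>A\<in>sets \<mu>.
            emeasure \<mu> A = (SUP K\<in>{K. compactin X K \<and> K \<subseteq> A}. emeasure \<mu> K) \<and>
            emeasure \<mu> A = (INF U\<in>{U. openin X U \<and> A \<subseteq> U}. emeasure \<mu> U))}"

(* The initial topology for the functionals "\<mu> \<mapsto> \<integral> f d\<mu>", f continuous. Real-valued f
   induce the same topology as complex-valued ones. *)
definition prob_measures_topology :: "'a topology \<Rightarrow> 'a measure topology" where
  "prob_measures_topology X = topology_generated_by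
     {{\<mu> \<in> regular_prob_measures X. (\<integral>x. f x \<partial>\<mu>) \<in> V} | f V.
        continuous_map X euclideanreal f \<and> open V}"

lemma topspace_prob_measures_topology:
  "topspace (prob_measures_topology X) = regular_prob_measures X"
proof -
  have "regular_prob_measures X \<in>
      {{\<mu> \<in> regular_prob_measures X. (\<integral>x. f x \<partial>\<mu>) \<in> V} | f V.
        continuous_map X euclideanreal f \<and> open V}"
    by (intro CollectI exI[of _ "\<lambda>_. 0"] exI[of _ UNIV]) auto
  then show ?thesis
    unfolding prob_measures_topology_def topology_generated_by_topspace by blast
qed

definition pushforward :: "'b topology \<Rightarrow> ('a \<Rightarrow> 'b) \<Rightarrow> 'a measure \<Rightarrow> 'b measure" where
  "pushforward Y \<phi> \<mu> = distr \<mu> (borel_of Y) \<phi>"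

end

theory Submission
  imports Defs
begin

text \<open>
  An extension of minimal flows is itself a semi-open map: by minimality, finitely many
  translates of a closed set with nonempty interior cover \<open>X\<close>, so finitely many translates of
  its image cover \<open>Y\<close>, and the image has nonempty interior (\<open>minimal_extension_semi_open\<close>).
  What remains is a statement about an arbitrary semi-open map \<open>\<phi>\<close> between compact Hausdorff
  spaces (\<open>semi_open_pushforward\<close>).

  A weak* open set around \<open>\<mu>0\<close> contains all measures that have almost the mass \<open>a p\<close> on a
  closed neighbourhood \<open>A p\<close> of \<open>p\<close>, for finitely many points \<open>p\<close> and weights \<open>a p\<close> with sum 1
  (\<open>open_contains_mass_condition\<close>). As \<open>\<phi>\<close> is semi-open, \<open>\<phi> ` A p\<close> has an interior
  point \<open>y p\<close>. The measures on \<open>Y\<close> with almost the mass \<open>a p\<close> near each \<open>y p\<close>, where the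
  masses are added up for points that coincide, contain a nonempty weak* open set
  (\<open>mass_condition_contains_open\<close>). Each of them has a lift with almost the mass \<open>a p\<close> on
  every \<open>A p\<close> (\<open>lift_measure\<close>), so this open set lies in the image.

  Lifting a measure \<open>\<nu>\<close> through a continuous surjection is commonly done with the
  theorems of Hahn-Banach and Riesz. Here it is done with set functions. The map
  \<open>K \<mapsto> \<nu> (\<phi> ` K)\<close> on closed sets is monotone and submodular. A minimal function of this kind
  below it, with the same total mass, exists by Zorn's lemma and is modular: for every closed
  \<open>A\<close> the function \<open>K \<mapsto> \<sigma> (K \<inter> A) + \<sigma> (K \<union> A) - \<sigma> A\<close> is a competitor, so minimality forces
  equality in the submodular inequality (\<open>modular_capacity_below\<close>). A modular function of
  closed sets generates a regular Borel measure by the Caratheodory construction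
  (\<open>regular_measure_below_capacity\<close>).
\<close>

section \<open>Borel sets and regular probability measures\<close>

lemma regular_prob_measuresD:
  assumes "\<mu> \<in> regular_prob_measures X"
  shows "prob_space \<mu>" "sets \<mu> = sets (borel_of X)" "space \<mu> = topspace X"
proof -
  show *: "prob_space \<mu>" "sets \<mu> = sets (borel_of X)"
    using assms by (auto simp: regular_prob_measures_def)
  show "space \<mu> = topspace X"
    using sets_eq_imp_space_eq[OF *(2)] unfolding borel_of_def
    by (subst (asm) space_measure_of) (auto dest: openin_subset)
qed

lemma sets_borel_of: "sets (borel_of X) = sigma_sets (topspace X) {U. openin X U}"
  unfolding borel_of_def by (rule sets_measure_of) (auto dest: openin_subset)

lemma space_borel_of [simp]: "space (borel_of X) = topspace X"
  unfolding borel_of_def by (rule space_measure_of) (auto dest: openin_subset)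

lemma openin_borel_of: "openin X U \<Longrightarrow> U \<in> sets (borel_of X)"
  unfolding sets_borel_of by auto

lemma closedin_borel_of:
  assumes "closedin X K"
  shows "K \<in> sets (borel_of X)"
proof -
  have "topspace X - (topspace X - K) \<in> sets (borel_of X)"
    using assms unfolding sets_borel_of by (intro sigma_sets.Compl sigma_sets.Basic) auto
  moreover have "topspace X - (topspace X - K) = K"
    using closedin_subset[OF assms] by blast
  ultimately show ?thesis by simp
qed

lemma continuous_map_borel_measurable:
  assumes "continuous_map X Y f"
  shows "f \<in> measurable (borel_of X) (borel_of Y)"
  unfolding borel_of_def[of Y]
proof (rule measurable_measure_of)
  show "{U. openin Y U} \<subseteq> Pow (topspace Y)"
    by (auto dest: openin_subset)
  show "f \<in> space (borel_of X) \<rightarrow> topspace Y"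
    using assms by (auto simp: continuous_map_def)
  show "f -` U \<inter> space (borel_of X) \<in> sets (borel_of X)" if "U \<in> {U. openin Y U}" for U
  proof -
    have "openin X {x \<in> topspace X. f x \<in> U}"
      using openin_continuous_map_preimage[OF assms] that by auto
    moreover have "f -` U \<inter> space (borel_of X) = {x \<in> topspace X. f x \<in> U}" by auto
    ultimately show ?thesis by (metis openin_borel_of)
  qed
qed

lemma borel_of_euclidean: "sets (borel_of euclidean) = sets borel"
  unfolding sets_borel_of borel_def by simp

lemma continuous_real_borel_measurable:
  assumes "continuous_map X euclideanreal f"
  shows "f \<in> borel_measurable (borel_of X)"
  using continuous_map_borel_measurable[OF assms] measurable_cong_sets[OF refl borel_of_euclidean]
  by blast

lemma continuous_real_bounded:
  assumes "compact_space X" "continuous_map X euclideanreal f"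
  obtains M where "M > 0" "\<And>x. x \<in> topspace X \<Longrightarrow> \<bar>f x\<bar> \<le> M"
proof -
  have "compact (f ` topspace X)"
    using assms image_compactin[of X "topspace X" euclideanreal f] by (simp add: compact_space_def)
  then obtain M where "M > 0" "\<forall>y\<in>f ` topspace X. norm y \<le> M"
    using compact_imp_bounded bounded_pos by metis
  then show thesis using that by auto
qed

lemma continuous_real_integrable:
  assumes "compact_space X" "\<mu> \<in> regular_prob_measures X" "continuous_map X euclideanreal f"
  shows "integrable \<mu> f"
proof -
  interpret prob_space \<mu> using assms(2) by (rule regular_prob_measuresD)
  obtain M where "\<And>x. x \<in> topspace X \<Longrightarrow> \<bar>f x\<bar> \<le> M"
    using continuous_real_bounded[OF assms(1,3)] by blast
  then show ?thesis
    using continuous_real_borel_measurable[OF assms(3)]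
      regular_prob_measuresD(2,3)[OF assms(2)]
    by (intro integrable_const_bound[of _ M]) (auto cong: measurable_cong_sets)
qed

text \<open>
  On a compact space outer regularity suffices: the complement of an open set that
  approximates the complement of \<open>A\<close> from outside is compact and approximates \<open>A\<close> from
  inside.
\<close>
lemma regular_prob_measuresI:
  assumes X: "compact_space X"
    and \<mu>: "prob_space \<mu>" "sets \<mu> = sets (borel_of X)"
    and outer: "\<And>A e. A \<in> sets \<mu> \<Longrightarrow> e > 0
                  \<Longrightarrow> \<exists>U. openin X U \<and> A \<subseteq> U \<and> measure \<mu> U \<le> measure \<mu> A + e"
  shows "\<mu> \<in> regular_prob_measures X"
proof -
  interpret prob_space \<mu> by fact
  have sp: "space \<mu> = topspace X"
    using sets_eq_imp_space_eq[OF \<mu>(2)] by simp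
  have "emeasure \<mu> A = (SUP K\<in>{K. compactin X K \<and> K \<subseteq> A}. emeasure \<mu> K)"
    if A: "A \<in> sets \<mu>" for A
  proof (rule antisym)
    show "(SUP K\<in>{K. compactin X K \<and> K \<subseteq> A}. emeasure \<mu> K) \<le> emeasure \<mu> A"
      using A by (auto intro!: SUP_least emeasure_mono)
    show "emeasure \<mu> A \<le> (SUP K\<in>{K. compactin X K \<and> K \<subseteq> A}. emeasure \<mu> K)"
    proof (rule ennreal_le_epsilon)
      fix e :: real assume "e > 0"
      then obtain U where U: "openin X U" "space \<mu> - A \<subseteq> U" 
         "measure \<mu> U \<le> measure \<mu> (space \<mu> - A) + e"
        using outer[of "space \<mu> - A" e] A by auto
      define K where "K = topspace X - U"
      have K: "compactin X K" "K \<subseteq> A"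
        using U X sp A sets.sets_into_space[OF A] unfolding K_def
        by (auto intro: closedin_compact_space)
      have Us: "U \<in> sets \<mu>" using U(1) \<mu>(2) openin_borel_of by blast
      have "measure \<mu> A \<le> measure \<mu> K + e"
        using U(3) prob_compl[OF A] prob_compl[OF Us] by (simp add: K_def sp)
      then have "emeasure \<mu> A \<le> emeasure \<mu> K + ennreal e"
        using \<open>e > 0\<close> by (simp add: emeasure_eq_measure flip: ennreal_plus)
      also have "\<dots> \<le> (SUP K\<in>{K. compactin X K \<and> K \<subseteq> A}. emeasure \<mu> K) + ennreal e"
        using K by (intro add_right_mono SUP_upper) auto
      finally show "emeasure \<mu> A \<le> (SUP K\<in>{K. compactin X K \<and> K \<subseteq> A}. emeasure \<mu> K) + ennreal e" .
    qed
  qed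
  moreover have "emeasure \<mu> A = (INF U\<in>{U. openin X U \<and> A \<subseteq> U}. emeasure \<mu> U)"
    if A: "A \<in> sets \<mu>" for A
  proof (rule antisym)
    show "emeasure \<mu> A \<le> (INF U\<in>{U. openin X U \<and> A \<subseteq> U}. emeasure \<mu> U)"
      using openin_borel_of \<mu>(2) by (auto intro!: INF_greatest emeasure_mono)
    show "(INF U\<in>{U. openin X U \<and> A \<subseteq> U}. emeasure \<mu> U) \<le> emeasure \<mu> A"
    proof (rule ennreal_le_epsilon)
      fix e :: real assume "e > 0"
      then obtain U where U: "openin X U" "A \<subseteq> U" "measure \<mu> U \<le> measure \<mu> A + e"
        using outer A by blast
      have "(INF U\<in>{U. openin X U \<and> A \<subseteq> U}. emeasure \<mu> U) \<le> emeasure \<mu> U"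
        using U by (intro INF_lower) auto
      also have "\<dots> \<le> emeasure \<mu> A + ennreal e"
        using U(3) \<open>e > 0\<close> by (simp add: emeasure_eq_measure flip: ennreal_plus)
      finally show "(INF U\<in>{U. openin X U \<and> A \<subseteq> U}. emeasure \<mu> U) \<le> emeasure \<mu> A + ennreal e" .
    qed
  qed
  ultimately show ?thesis
    using \<mu> by (simp add: regular_prob_measures_def)
qed

lemma regular_prob_measures_outer:
  assumes "\<mu> \<in> regular_prob_measures X" "A \<in> sets \<mu>" "e > 0"
  obtains U where "openin X U" "A \<subseteq> U" "measure \<mu> U \<le> measure \<mu> A + e"
proof -
  interpret prob_space \<mu> using assms(1) by (rule regular_prob_measuresD)
  have "(INF U\<in>{U. openin X U \<and> A \<subseteq> U}. emeasure \<mu> U) < emeasure \<mu> A + ennreal e"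
  proof -
    have "emeasure \<mu> A < emeasure \<mu> A + ennreal e"
      using \<open>e > 0\<close> by (simp add: emeasure_eq_measure ennreal_less_iff flip: ennreal_plus)
    moreover have "emeasure \<mu> A = (INF U\<in>{U. openin X U \<and> A \<subseteq> U}. emeasure \<mu> U)"
      using assms unfolding regular_prob_measures_def by blast
    ultimately show ?thesis by simp
  qed
  then obtain U where "openin X U" "A \<subseteq> U" "emeasure \<mu> U < emeasure \<mu> A + ennreal e"
    by (auto simp: INF_less_iff)
  with that show thesis using \<open>e > 0\<close>
    by (auto simp: emeasure_eq_measure ennreal_less_iff simp flip: ennreal_plus)
qed

lemma regular_prob_measures_inner:
  assumes "\<mu> \<in> regular_prob_measures X" "A \<in> sets \<mu>" "e > 0"
  obtains K where "compactin X K" "K \<subseteq> A" "measure \<mu> A \<le> measure \<mu> K + e"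
proof (cases "measure \<mu> A < e")
  case True
  then show thesis using that[of "{}"] by auto
next
  case False
  interpret prob_space \<mu> using assms(1) by (rule regular_prob_measuresD)
  have "ennreal (measure \<mu> A - e) < (SUP K\<in>{K. compactin X K \<and> K \<subseteq> A}. emeasure \<mu> K)"
  proof -
    have "ennreal (measure \<mu> A - e) < emeasure \<mu> A"
      using False \<open>e > 0\<close> by (simp add: emeasure_eq_measure ennreal_less_iff)
    moreover have "emeasure \<mu> A = (SUP K\<in>{K. compactin X K \<and> K \<subseteq> A}. emeasure \<mu> K)"
      using assms unfolding regular_prob_measures_def by blast
    ultimately show ?thesis by simp
  qed
  then obtain K where "compactin X K" "K \<subseteq> A" "ennreal (measure \<mu> A - e) < emeasure \<mu> K"
    by (auto simp: less_SUP_iff)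
  with that False show thesis
    by (auto simp: emeasure_eq_measure ennreal_less_iff)
qed

section \<open>Separation in compact Hausdorff spaces\<close>

lemma closed_neighbourhood:
  assumes "compact_space X" "Hausdorff_space X" "openin X U" "x \<in> U"
  obtains V A where "openin X V" "closedin X A" "x \<in> V" "V \<subseteq> A" "A \<subseteq> U"
  using compact_Hausdorff_imp_regular_space[OF assms(1,2)] assms(3,4)
  unfolding neighbourhood_base_of_closedin[symmetric] neighbourhood_base_of by metis

lemma finite_disjoint_neighbourhoods:
  assumes X: "Hausdorff_space X" and "finite P" and P: "P \<subseteq> topspace X"
  obtains D where "\<And>x. x \<in> P \<Longrightarrow> openin X (D x)" "\<And>x. x \<in> P \<Longrightarrow> x \<in> D x"
    "disjoint_family_on D P"
proof -
  have "\<forall>x y. \<exists>U V. x \<in> P \<longrightarrow> y \<in> P \<longrightarrow> x \<noteq> y \<longrightarrow>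
      openin X U \<and> openin X V \<and> x \<in> U \<and> y \<in> V \<and> disjnt U V"
    using X P unfolding Hausdorff_space_def by (meson subsetD)
  then obtain U V where UV: "\<And>x y. x \<in> P \<Longrightarrow> y \<in> P \<Longrightarrow> x \<noteq> y \<Longrightarrow>
      openin X (U x y) \<and> openin X (V x y) \<and> x \<in> U x y \<and> y \<in> V x y \<and> disjnt (U x y) (V x y)"
    by metis
  define D where "D x = topspace X \<inter> (\<Inter>y\<in>P - {x}. U x y \<inter> V y x)" for x
  have "openin X (D x)" if "x \<in> P" for x
  proof (cases "P - {x} = {}")
    case False
    then show ?thesis unfolding D_def using UV that \<open>finite P\<close>
      by (intro openin_Int openin_topspace openin_INT2 openin_Int) auto
  next
    case True
    then show ?thesis unfolding D_def by (simp only: image_empty Inf_empty) simp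
  qed
  moreover have "x \<in> D x" if "x \<in> P" for x
    using that UV P by (auto simp: D_def)
  moreover have "disjoint_family_on D P"
    unfolding disjoint_family_on_def D_def using UV by (fastforce simp: disjnt_iff)
  ultimately show thesis by (rule that)
qed

text \<open>
  Normality separates the part of \<open>K\<close> outside \<open>U\<close> from the part outside \<open>V\<close>. This is what
  turns subadditivity on closed sets into subadditivity on open sets.
\<close>
lemma closedin_split_open_cover:
  assumes "compact_space X" "Hausdorff_space X"
    and "closedin X K" "openin X U" "openin X V" "K \<subseteq> U \<union> V"
  obtains A B where "closedin X A" "closedin X B" "A \<subseteq> U" "B \<subseteq> V" "K = A \<union> B"
proof -
  have "normal_space X"
    using compact_Hausdorff_or_regular_imp_normal_space assms by blast
  moreover have "closedin X (K - V)" "closedin X (K - U)" "disjnt (K - V) (K - U)"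
    using assms by (auto simp: disjnt_iff)
  ultimately obtain G H where "openin X G" "openin X H" "K - V \<subseteq> G" "K - U \<subseteq> H" "disjnt G H"
    unfolding normal_space_def by meson
  then show thesis
    using assms by (intro that[of "K - H" "K - G"]) (auto simp: disjnt_iff)
qed

lemma interior_of_finite_Union_closed:
  assumes "finite I" "\<And>i. i \<in> I \<Longrightarrow> closedin X (C i)" "\<And>i. i \<in> I \<Longrightarrow> X interior_of C i = {}"
  shows "X interior_of (\<Union>i\<in>I. C i) = {}"
  using assms by (induction I rule: finite_induct) (auto simp: interior_of_union_eq_empty)

section \<open>Extensions of minimal flows are semi-open\<close>

lemma (in flow) act_closed: "t \<in> carrier S \<Longrightarrow> x \<in> topspace X \<Longrightarrow> act t x \<in> topspace X"
  using continuous_act by (auto simp: continuous_map_def)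

lemma (in flow) act_inv:
  assumes "t \<in> carrier S" "x \<in> topspace X"
  shows "act (inv t) (act t x) = x" "act t (act (inv t) x) = x"
  using act_mult[of "inv t" t x] act_mult[of t "inv t" x] assms by (simp_all add: act_one)

text \<open>
  Inside \<open>U\<close> take a closed set \<open>A\<close> with nonempty interior. Every orbit meets the interior of
  \<open>A\<close>, so by compactness finitely many translates of \<open>A\<close> cover \<open>X\<close>, and the same translates
  of \<open>\<phi> ` A\<close> cover \<open>Y\<close>. One of these finitely many closed sets has nonempty interior, and
  translations of \<open>Y\<close> are homeomorphisms because \<open>S\<close> is a group.
\<close>
lemma minimal_extension_semi_open:
  assumes "minimal_flow S X actX" "flow_extension S X actX Y actY \<phi>"
  shows "semi_open_map X Y \<phi>"
proof -
  interpret X: minimal_flow S X actX by fact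
  interpret flow_extension S X actX Y actY \<phi> by fact
  have "Y interior_of (\<phi> ` U) \<noteq> {}" if U: "openin X U" "U \<noteq> {}" for U
  proof -
    obtain x where "x \<in> U" using U by blast
    then obtain V A where VA: "openin X V" "closedin X A" "x \<in> V" "V \<subseteq> A" "A \<subseteq> U"
      using closed_neighbourhood[OF X.compact X.Hausdorff U(1)] by metis
    define W where "W t = {z \<in> topspace X. actX t z \<in> V}" for t
    have W: "openin X (W t)" if "t \<in> carrier S" for t
      unfolding W_def using VA that X.continuous_act by (intro openin_continuous_map_preimage) auto
    have "topspace X \<subseteq> \<Union> (W ` carrier S)"
    proof
      fix z assume z: "z \<in> topspace X"
      have "x \<in> X closure_of ((\<lambda>t. actX t z) ` carrier S)"
        using X.dense_orbit[OF z] VA openin_subset by blast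
      then obtain t where "t \<in> carrier S" "actX t z \<in> V"
        using VA by (auto simp: in_closure_of)
      then show "z \<in> \<Union> (W ` carrier S)" using z by (auto simp: W_def)
    qed
    moreover have "\<forall>U\<in>W ` carrier S. openin X U" using W by auto
    ultimately obtain \<F> where F: "finite \<F>" "\<F> \<subseteq> W ` carrier S" "topspace X \<subseteq> \<Union>\<F>"
      using X.compact unfolding compact_space_alt by meson
    then obtain T where T: "finite T" "T \<subseteq> carrier S" "topspace X \<subseteq> \<Union> (W ` T)"
      by (metis finite_subset_image)
    \<comment> \<open>\<open>C t\<close> is the translate of \<open>\<phi> ` A\<close> by the inverse of \<open>t\<close>.\<close>
    define C where "C t = {y \<in> topspace Y. actY t y \<in> \<phi> ` A}" for t
    have "closedin Y (\<phi> ` A)"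
      using continuous_imp_closed_map[OF continuous X.compact Y.Hausdorff] VA
      by (auto simp: closed_map_def)
    then have C: "closedin Y (C t)" if "t \<in> T" for t
      unfolding C_def using that T Y.continuous_act
      by (intro closedin_continuous_map_preimage) auto
    have "(\<Union>t\<in>T. C t) = topspace Y"
    proof
      show "topspace Y \<subseteq> (\<Union>t\<in>T. C t)"
      proof
        fix y assume y: "y \<in> topspace Y"
        then obtain z where z: "z \<in> topspace X" "y = \<phi> z" using onto by auto
        then obtain t where t: "t \<in> T" "z \<in> W t" using T by auto
        then have "actX t z \<in> A" "actY t y = \<phi> (actX t z)"
          using z VA T equivariant[of t z] by (auto simp: W_def)
        then show "y \<in> (\<Union>t\<in>T. C t)" using t y by (auto simp: C_def)
      qed
    qed (auto simp: C_def)
    moreover have "topspace Y \<noteq> {}"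
      using \<open>x \<in> U\<close> openin_subset[OF U(1)] onto by blast
    ultimately have "Y interior_of (\<Union>t\<in>T. C t) \<noteq> {}"
      by (simp only: interior_of_topspace) simp
    moreover have "Y interior_of (\<Union>t\<in>T. C t) = {}" if "\<forall>t\<in>T. Y interior_of C t = {}"
      using T(1) C that by (intro interior_of_finite_Union_closed) auto
    ultimately obtain t where t: "t \<in> T" "Y interior_of C t \<noteq> {}"
      by blast
    have tS: "t \<in> carrier S" "inv\<^bsub>S\<^esub> t \<in> carrier S" using t T X.inv_closed by auto
    define G where "G = {y \<in> topspace Y. actY (inv\<^bsub>S\<^esub> t) y \<in> Y interior_of C t}"
    have "openin Y G"
      unfolding G_def using Y.continuous_act tS by (intro openin_continuous_map_preimage) auto
    moreover have "G \<subseteq> \<phi> ` U"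
    proof
      fix y assume "y \<in> G"
      then have "y \<in> topspace Y" "actY (inv\<^bsub>S\<^esub> t) y \<in> C t"
        unfolding G_def using interior_of_subset[of Y "C t"] by blast+
      then show "y \<in> \<phi> ` U"
        using VA Y.act_inv(2)[OF tS(1)] by (auto simp: C_def)
    qed
    moreover have "G \<noteq> {}"
    proof -
      obtain y where y: "y \<in> Y interior_of C t" using t by auto
      then have "y \<in> topspace Y" using interior_of_subset_topspace by fastforce
      then have "actY t y \<in> G"
        using y tS Y.act_inv(1)[of t y] Y.act_closed[of t y] unfolding G_def by simp
      then show ?thesis by auto
    qed
    ultimately show ?thesis using interior_of_maximal[of G "\<phi> ` U" Y] by blast
  qed
  then show ?thesis using continuous onto by (simp add: semi_open_map_def)
qed

section \<open>Submodular functions of closed sets\<close>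

text \<open>
  The model is \<open>K \<mapsto> \<nu> (\<phi> ` K)\<close> for a measure \<open>\<nu>\<close> on a continuous image: the image of an
  intersection is contained in the intersection of the images, so additivity of \<open>\<nu>\<close> leaves
  submodularity. The value of \<open>\<tau>\<close> on sets that are not closed is arbitrary.
\<close>
definition closed_capacity :: "'a topology \<Rightarrow> ('a set \<Rightarrow> real) \<Rightarrow> bool" where
  "closed_capacity X \<tau> \<longleftrightarrow> \<tau> {} = 0 \<and>
     (\<forall>K L. closedin X K \<longrightarrow> closedin X L \<longrightarrow>
        (K \<subseteq> L \<longrightarrow> \<tau> K \<le> \<tau> L) \<and> \<tau> (K \<union> L) + \<tau> (K \<inter> L) \<le> \<tau> K + \<tau> L)"

lemma closed_capacityD:
  assumes "closed_capacity X \<tau>"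
  shows "\<tau> {} = 0"
    and "\<And>K L. closedin X K \<Longrightarrow> closedin X L \<Longrightarrow> K \<subseteq> L \<Longrightarrow> \<tau> K \<le> \<tau> L"
    and "\<And>K L. closedin X K \<Longrightarrow> closedin X L \<Longrightarrow> \<tau> (K \<union> L) + \<tau> (K \<inter> L) \<le> \<tau> K + \<tau> L"
    and "\<And>K. closedin X K \<Longrightarrow> 0 \<le> \<tau> K"
proof -
  show *: "\<tau> {} = 0" 
     and mono: "\<And>K L. closedin X K \<Longrightarrow> closedin X L \<Longrightarrow> K \<subseteq> L \<Longrightarrow> \<tau> K \<le> \<tau> L"
     and "\<And>K L. closedin X K \<Longrightarrow> closedin X L \<Longrightarrow> \<tau> (K \<union> L) + \<tau> (K \<inter> L) \<le> \<tau> K + \<tau> L"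
    using assms unfolding closed_capacity_def by blast+
  show "0 \<le> \<tau> K" if "closedin X K" for K
    using mono[of "{}" K] * that by simp
qed

text \<open>
  Submodularity of \<open>\<tau>\<close> at \<open>K\<close> and \<open>A\<close> says precisely that this new function is at most
  \<open>\<tau>\<close>, and its value on the whole space is that of \<open>\<tau>\<close>. Hence if \<open>\<tau>\<close> is minimal, the two
  functions agree, which is modularity of \<open>\<tau>\<close>.
\<close>
lemma closed_capacity_exchange:
  assumes \<tau>: "closed_capacity X \<tau>" and A: "closedin X A"
  shows "closed_capacity X (\<lambda>K. \<tau> (K \<inter> A) + \<tau> (K \<union> A) - \<tau> A)"
  unfolding closed_capacity_def
proof (intro conjI allI impI)
  show "\<tau> ({} \<inter> A) + \<tau> ({} \<union> A) - \<tau> A = 0"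
    by (simp add: closed_capacityD(1)[OF \<tau>])
  fix K L assume K: "closedin X K" and L: "closedin X L"
  show "\<tau> (K \<inter> A) + \<tau> (K \<union> A) - \<tau> A \<le> \<tau> (L \<inter> A) + \<tau> (L \<union> A) - \<tau> A" if "K \<subseteq> L"
    using closed_capacityD(2)[OF \<tau>, of "K \<inter> A" "L \<inter> A"]
      closed_capacityD(2)[OF \<tau>, of "K \<union> A" "L \<union> A"] K L A that by fastforce
  have "\<tau> ((K \<union> L) \<inter> A) + \<tau> ((K \<inter> L) \<inter> A) \<le> \<tau> (K \<inter> A) + \<tau> (L \<inter> A)"
  proof -
    have "(K \<union> L) \<inter> A = (K \<inter> A) \<union> (L \<inter> A)" "(K \<inter> L) \<inter> A = (K \<inter> A) \<inter> (L \<inter> A)" by auto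
    then show ?thesis
      using closed_capacityD(3)[OF \<tau>, of "K \<inter> A" "L \<inter> A"] K L A by (simp add: closedin_Int)
  qed
  moreover have "\<tau> ((K \<union> L) \<union> A) + \<tau> ((K \<inter> L) \<union> A) \<le> \<tau> (K \<union> A) + \<tau> (L \<union> A)"
  proof -
    have "(K \<union> L) \<union> A = (K \<union> A) \<union> (L \<union> A)" "(K \<inter> L) \<union> A = (K \<union> A) \<inter> (L \<union> A)" by auto
    then show ?thesis
      using closed_capacityD(3)[OF \<tau>, of "K \<union> A" "L \<union> A"] K L A by (simp add: closedin_Un)
  qed
  ultimately show "\<tau> ((K \<union> L) \<inter> A) + \<tau> (K \<union> L \<union> A) - \<tau> A + (\<tau> (K \<inter> L \<inter> A) + \<tau> (K \<inter> L \<union> A) - \<tau> A)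
      \<le> \<tau> (K \<inter> A) + \<tau> (K \<union> A) - \<tau> A + (\<tau> (L \<inter> A) + \<tau> (L \<union> A) - \<tau> A)"
    by linarith
qed

text \<open>
  In a chain, of two members used to estimate the values at \<open>K\<close> and at \<open>L\<close> the smaller one
  serves for both, so submodularity passes to the infimum.
\<close>
lemma closed_capacity_Inf_chain:
  assumes C: "C \<noteq> {}" "\<And>\<sigma>. \<sigma> \<in> C \<Longrightarrow> closed_capacity X \<sigma>"
    and chain: "\<And>\<sigma> \<rho>. \<sigma> \<in> C \<Longrightarrow> \<rho> \<in> C \<Longrightarrow> \<sigma> \<le> \<rho> \<or> \<rho> \<le> \<sigma>"
  shows "closed_capacity X (\<lambda>K. INF \<sigma>\<in>C. \<sigma> K)"
proof -
  have bdd: "bdd_below ((\<lambda>\<sigma>. \<sigma> K) ` C)" if "closedin X K" for K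
    using C(2) closed_capacityD(4) that by (intro bdd_belowI2[of _ 0]) blast
  have "(INF \<sigma>\<in>C. \<sigma> {}) = 0"
    using C closed_capacityD(1) by (subst INF_cong[OF refl, of _ _ "\<lambda>_. 0"]) auto
  moreover have "(INF \<sigma>\<in>C. \<sigma> K) \<le> (INF \<sigma>\<in>C. \<sigma> L)"
    if "closedin X K" "closedin X L" "K \<subseteq> L" for K L
    using C(2) closed_capacityD(2) that by (intro cINF_mono C(1) bdd) blast+
  moreover have "(INF \<sigma>\<in>C. \<sigma> (K \<union> L)) + (INF \<sigma>\<in>C. \<sigma> (K \<inter> L)) \<le> (INF \<sigma>\<in>C. \<sigma> K) + (INF \<sigma>\<in>C. \<sigma> L)"
    if K: "closedin X K" and L: "closedin X L" for K L
  proof -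
    let ?s = "(INF \<sigma>\<in>C. \<sigma> (K \<union> L)) + (INF \<sigma>\<in>C. \<sigma> (K \<inter> L))"
    have same: "?s \<le> \<sigma> K + \<sigma> L" if "\<sigma> \<in> C" for \<sigma>
    proof -
      have "?s \<le> \<sigma> (K \<union> L) + \<sigma> (K \<inter> L)"
        using K L that by (intro add_mono cINF_lower bdd) auto
      also have "\<dots> \<le> \<sigma> K + \<sigma> L"
        using closed_capacityD(3)[OF C(2)] that K L by blast
      finally show ?thesis .
    qed
    have "?s \<le> \<sigma> K + \<rho> L" if "\<sigma> \<in> C" "\<rho> \<in> C" for \<sigma> \<rho>
      using chain[OF that] same[OF that(1)] same[OF that(2)]
      by (fastforce simp: le_fun_def dest: spec[of _ K] spec[of _ L])
    then have "?s - \<rho> L \<le> (INF \<sigma>\<in>C. \<sigma> K)" if "\<rho> \<in> C" for \<rho>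
      using that by (intro cINF_greatest C(1)) (simp add: algebra_simps)
    then have "?s - (INF \<sigma>\<in>C. \<sigma> K) \<le> (INF \<sigma>\<in>C. \<sigma> L)"
      by (intro cINF_greatest C(1)) (simp add: algebra_simps)
    then show ?thesis by linarith
  qed
  ultimately show ?thesis
    unfolding closed_capacity_def by blast
qed

text \<open>
  A minimal element among the capacities below \<open>\<tau>\<close> with the same total mass, given by Zorn's
  lemma. This step takes the place of the Hahn-Banach theorem.
\<close>
lemma modular_capacity_below:
  assumes \<tau>: "closed_capacity X \<tau>"
  obtains \<sigma> where "closed_capacity X \<sigma>" "\<sigma> (topspace X) = \<tau> (topspace X)"
    "\<And>K. closedin X K \<Longrightarrow> \<sigma> K \<le> \<tau> K"
    "\<And>K L. closedin X K \<Longrightarrow> closedin X L \<Longrightarrow> \<sigma> (K \<union> L) + \<sigma> (K \<inter> L) = \<sigma> K + \<sigma> L"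
proof -
  \<comment> \<open>The value 0 off the closed sets makes the pointwise order antisymmetric.\<close>
  define \<S> where "\<S> = {\<sigma>. closed_capacity X \<sigma> \<and> \<sigma> (topspace X) = \<tau> (topspace X) \<and>
     (\<forall>K. closedin X K \<longrightarrow> \<sigma> K \<le> \<tau> K) \<and> (\<forall>K. \<not> closedin X K \<longrightarrow> \<sigma> K = 0)}"
  have restrict: "(\<lambda>K. if closedin X K then \<sigma> K else 0) \<in> \<S>"
    if "closed_capacity X \<sigma>" "\<sigma> (topspace X) = \<tau> (topspace X)" 
      "\<And>K. closedin X K \<Longrightarrow> \<sigma> K \<le> \<tau> K" for \<sigma>
    using that unfolding \<S>_def closed_capacity_def by (simp add: closedin_Un closedin_Int)
  have "\<exists>\<sigma>\<in>\<S>. \<forall>\<rho>\<in>\<S>. \<rho> \<le> \<sigma> \<longrightarrow> \<rho> = \<sigma>"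
  proof (rule predicate_Zorn)
    show "partial_order_on \<S> (relation_of (\<lambda>\<sigma> \<rho>. \<rho> \<le> \<sigma>) \<S>)"
      by (rule partial_order_on_relation_ofI) auto
    fix C assume "C \<in> Chains (relation_of (\<lambda>\<sigma> \<rho>. \<rho> \<le> \<sigma>) \<S>)"
    then have C: "C \<subseteq> \<S>" and chain: "\<And>\<sigma> \<rho>. \<sigma> \<in> C \<Longrightarrow> \<rho> \<in> C \<Longrightarrow> \<sigma> \<le> \<rho> \<or> \<rho> \<le> \<sigma>"
      by (auto simp: Chains_def relation_of_def)
    show "\<exists>u\<in>\<S>. \<forall>\<sigma>\<in>C. u \<le> \<sigma>"
    proof (cases "C = {}")
      case True
      then show ?thesis using restrict[of \<tau>] \<tau> by auto
    next
      case False
      then obtain \<sigma>0 where \<sigma>0: "\<sigma>0 \<in> C" by blast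
      have cap: "\<And>\<sigma>. \<sigma> \<in> C \<Longrightarrow> closed_capacity X \<sigma>" using C by (auto simp: \<S>_def)
      let ?u = "\<lambda>K. INF \<sigma>\<in>C. \<sigma> K"
      have low: "?u K \<le> \<sigma> K" if "\<sigma> \<in> C" "closedin X K" for \<sigma> K
        using cap closed_capacityD(4) that
        by (intro cINF_lower bdd_belowI2[of _ 0]) blast+
      have "(\<lambda>K. if closedin X K then ?u K else 0) \<in> \<S>"
      proof (rule restrict)
        show "closed_capacity X ?u"
          using closed_capacity_Inf_chain[OF False cap chain] .
        show "?u (topspace X) = \<tau> (topspace X)"
          using C False by (subst INF_cong[OF refl, of _ _ "\<lambda>_. \<tau> (topspace X)"]) (auto simp: \<S>_def)
        show "?u K \<le> \<tau> K" if "closedin X K" for K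
          using low[OF \<sigma>0 that] C \<sigma>0 that by (fastforce simp: \<S>_def)
      qed
      moreover have "(\<lambda>K. if closedin X K then ?u K else 0) \<le> \<sigma>" if "\<sigma> \<in> C" for \<sigma>
        using low[OF that] C that by (auto simp: le_fun_def \<S>_def)
      ultimately show ?thesis by blast
    qed
  qed
  then obtain \<sigma> where \<sigma>: "\<sigma> \<in> \<S>" and minimal: "\<And>\<rho>. \<rho> \<in> \<S> \<Longrightarrow> \<rho> \<le> \<sigma> \<Longrightarrow> \<rho> = \<sigma>"
    by blast
  have cap: "closed_capacity X \<sigma>" and top: "\<sigma> (topspace X) = \<tau> (topspace X)"
    and le: "\<And>K. closedin X K \<Longrightarrow> \<sigma> K \<le> \<tau> K"
    using \<sigma> by (auto simp: \<S>_def)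
  have "\<sigma> (K \<union> L) + \<sigma> (K \<inter> L) = \<sigma> K + \<sigma> L" if K: "closedin X K" and L: "closedin X L" for K L
  proof -
    define \<rho> where "\<rho> = (\<lambda>K. \<sigma> (K \<inter> L) + \<sigma> (K \<union> L) - \<sigma> L)"
    have \<rho>le: "\<rho> A \<le> \<sigma> A" if "closedin X A" for A
      using closed_capacityD(3)[OF cap that L] by (simp add: \<rho>_def)
    have "topspace X \<inter> L = L" "topspace X \<union> L = topspace X"
      using closedin_subset[OF L] by auto
    then have "\<rho> (topspace X) = \<tau> (topspace X)"
      by (simp add: \<rho>_def top)
    moreover have "closed_capacity X \<rho>"
      unfolding \<rho>_def by (rule closed_capacity_exchange[OF cap L])
    ultimately have "(\<lambda>K. if closedin X K then \<rho> K else 0) \<in> \<S>"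
      using \<rho>le le order_trans by (intro restrict) blast+
    moreover have "(\<lambda>K. if closedin X K then \<rho> K else 0) \<le> \<sigma>"
      using \<rho>le \<sigma> by (auto simp: le_fun_def \<S>_def)
    ultimately have "(\<lambda>K. if closedin X K then \<rho> K else 0) = \<sigma>"
      by (rule minimal)
    from fun_cong[OF this, of K] K show ?thesis
      by (simp add: \<rho>_def)
  qed
  with cap top le show thesis by (rule that)
qed

section \<open>The Borel measure of an additive capacity\<close>

text \<open>
  The usual passage from a content to an outer measure, with open sets approximated from
  inside by closed ones. As \<open>\<sigma>\<close> need not be continuous from above, the outer measure of a
  closed set may exceed its value under \<open>\<sigma>\<close>.
\<close>
definition open_mass :: "'a topology \<Rightarrow> ('a set \<Rightarrow> real) \<Rightarrow> 'a set \<Rightarrow> ennreal" where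
  "open_mass X \<sigma> U = (SUP K\<in>{K. closedin X K \<and> K \<subseteq> U}. ennreal (\<sigma> K))"

definition outer_mass :: "'a topology \<Rightarrow> ('a set \<Rightarrow> real) \<Rightarrow> 'a set \<Rightarrow> ennreal" where
  "outer_mass X \<sigma> A = (INF U\<in>{U. openin X U \<and> A \<subseteq> U}. open_mass X \<sigma> U)"

lemma open_mass_upper: "closedin X K \<Longrightarrow> K \<subseteq> U \<Longrightarrow> ennreal (\<sigma> K) \<le> open_mass X \<sigma> U"
  unfolding open_mass_def by (intro SUP_upper) auto

lemma open_mass_mono: "U \<subseteq> V \<Longrightarrow> open_mass X \<sigma> U \<le> open_mass X \<sigma> V"
  unfolding open_mass_def by (intro SUP_subset_mono) auto

lemma outer_mass_lower: "openin X U \<Longrightarrow> A \<subseteq> U \<Longrightarrow> outer_mass X \<sigma> A \<le> open_mass X \<sigma> U"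
  unfolding outer_mass_def by (intro INF_lower) auto

lemma outer_mass_mono: "A \<subseteq> B \<Longrightarrow> outer_mass X \<sigma> A \<le> outer_mass X \<sigma> B"
  unfolding outer_mass_def by (intro INF_superset_mono) auto

lemma outer_mass_open: "openin X U \<Longrightarrow> outer_mass X \<sigma> U = open_mass X \<sigma> U"
  by (intro antisym outer_mass_lower) (auto simp: outer_mass_def intro!: INF_greatest open_mass_mono)

context
  fixes X :: "'a topology" and \<sigma> :: "'a set \<Rightarrow> real"
  assumes X: "compact_space X" "Hausdorff_space X"
    and \<sigma>: "closed_capacity X \<sigma>"
begin

lemma open_mass_finite_cover:
  assumes "finite I" "\<And>i. i \<in> I \<Longrightarrow> openin X (U i)" "closedin X K" "K \<subseteq> (\<Union>i\<in>I. U i)"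
  shows "ennreal (\<sigma> K) \<le> (\<Sum>i\<in>I. open_mass X \<sigma> (U i))"
  using assms
proof (induction I arbitrary: K rule: finite_induct)
  case empty
  then show ?case by (simp add: closed_capacityD(1)[OF \<sigma>])
next
  case (insert i I)
  have "openin X (\<Union>i\<in>I. U i)" using insert.prems by auto
  then obtain A B where AB: "closedin X A" "closedin X B" "A \<subseteq> U i" "B \<subseteq> (\<Union>i\<in>I. U i)" "K = A \<union> B"
    using closedin_split_open_cover[OF X, of K "U i" "\<Union>i\<in>I. U i"] insert.prems by auto
  have "\<sigma> K \<le> \<sigma> A + \<sigma> B"
    using closed_capacityD(3)[OF \<sigma> AB(1,2)] closed_capacityD(4)[OF \<sigma>, of "A \<inter> B"] AB
    by (auto simp: closedin_Int)
  then have "ennreal (\<sigma> K) \<le> ennreal (\<sigma> A) + ennreal (\<sigma> B)"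
    using closed_capacityD(4)[OF \<sigma>] AB by (simp flip: ennreal_plus)
  also have "\<dots> \<le> open_mass X \<sigma> (U i) + (\<Sum>i\<in>I. open_mass X \<sigma> (U i))"
    using insert AB by (intro add_mono open_mass_upper insert.IH) auto
  finally show ?case using insert by simp
qed

lemma open_mass_subadditive:
  fixes U :: "nat \<Rightarrow> 'a set"
  assumes U: "\<And>i. openin X (U i)"
  shows "open_mass X \<sigma> (\<Union>i. U i) \<le> (\<Sum>i. open_mass X \<sigma> (U i))"
  unfolding open_mass_def[of _ _ "\<Union>i. U i"]
proof (rule SUP_least, clarify)
  fix K assume K: "closedin X K" "K \<subseteq> (\<Union>i. U i)"
  then have "compactin X K" using X closedin_compact_space by blast
  then obtain \<F> where "finite \<F>" "\<F> \<subseteq> range U" "K \<subseteq> \<Union>\<F>"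
    using compactinD[of X K "range U"] K U by auto
  then obtain I where I: "finite I" "K \<subseteq> (\<Union>i\<in>I. U i)"
    by (metis finite_subset_image)
  have "ennreal (\<sigma> K) \<le> (\<Sum>i\<in>I. open_mass X \<sigma> (U i))"
    using I U K by (intro open_mass_finite_cover)
  also have "\<dots> \<le> (\<Sum>i. open_mass X \<sigma> (U i))"
    using I by (intro sum_le_suminf) auto
  finally show "ennreal (\<sigma> K) \<le> (\<Sum>i. open_mass X \<sigma> (U i))" .
qed

lemma open_mass_finite: "openin X U \<Longrightarrow> open_mass X \<sigma> U \<le> ennreal (\<sigma> (topspace X))"
  unfolding open_mass_def
  using closed_capacityD(2)[OF \<sigma>] by (auto intro!: SUP_least ennreal_leI dest: closedin_subset)

lemma outer_mass_finite:
  assumes "A \<subseteq> topspace X" shows "outer_mass X \<sigma> A < \<top>"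
proof -
  have "outer_mass X \<sigma> A \<le> ennreal (\<sigma> (topspace X))"
    using outer_mass_lower[of X "topspace X" A \<sigma>] open_mass_finite[of "topspace X"] assms
    by (auto intro: order_trans)
  then show ?thesis using ennreal_less_top le_less_trans by blast
qed

lemma outer_measure_outer_mass: "outer_measure_space (Pow (topspace X)) (outer_mass X \<sigma>)"
  unfolding outer_measure_space_def
proof (intro conjI)
  have "open_mass X \<sigma> {} = 0"
    using closed_capacityD(1)[OF \<sigma>] by (auto simp: open_mass_def intro!: antisym SUP_least)
  then show "positive (Pow (topspace X)) (outer_mass X \<sigma>)"
    by (simp add: positive_def outer_mass_open)
  show "increasing (Pow (topspace X)) (outer_mass X \<sigma>)"
    by (simp add: increasing_def outer_mass_mono)
  show "countably_subadditive (Pow (topspace X)) (outer_mass X \<sigma>)"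
    unfolding countably_subadditive_def
  proof (intro allI impI)
    fix A :: "nat \<Rightarrow> 'a set" assume A: "range A \<subseteq> Pow (topspace X)"
    show "outer_mass X \<sigma> (\<Union>i. A i) \<le> (\<Sum>i. outer_mass X \<sigma> (A i))"
    proof (rule ennreal_le_epsilon)
      fix e :: real assume "0 < e"
      have "\<exists>U. openin X U \<and> A i \<subseteq> U \<and> open_mass X \<sigma> U \<le> outer_mass X \<sigma> (A i) + ennreal (e * (1/2) ^ Suc i)" for i
      proof -
        have "outer_mass X \<sigma> (A i) < outer_mass X \<sigma> (A i) + ennreal (e * (1/2) ^ Suc i)"
          using outer_mass_finite[of "A i"] A \<open>0 < e\<close>
          by (cases "outer_mass X \<sigma> (A i)") (auto simp: ennreal_less_iff simp flip: ennreal_plus)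
        from this[unfolded outer_mass_def[of _ _ "A i"] INF_less_iff] show ?thesis
          unfolding outer_mass_def by (auto intro: less_imp_le)
      qed
      then obtain U where U: "\<And>i. openin X (U i)" "\<And>i. A i \<subseteq> U i"
        "\<And>i. open_mass X \<sigma> (U i) \<le> outer_mass X \<sigma> (A i) + ennreal (e * (1/2) ^ Suc i)"
        by metis
      have "outer_mass X \<sigma> (\<Union>i. A i) \<le> open_mass X \<sigma> (\<Union>i. U i)"
        using U by (intro outer_mass_lower) blast+
      also have "\<dots> \<le> (\<Sum>i. open_mass X \<sigma> (U i))"
        by (rule open_mass_subadditive[OF U(1)])
      also have "\<dots> \<le> (\<Sum>i. outer_mass X \<sigma> (A i) + ennreal (e * (1/2) ^ Suc i))"
        by (rule suminf_le[OF U(3)]) auto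
      also have "\<dots> = (\<Sum>i. outer_mass X \<sigma> (A i)) + (\<Sum>i. ennreal (e * (1/2) ^ Suc i))"
        by (rule suminf_add[symmetric]) auto
      also have "(\<Sum>i. ennreal (e * (1/2) ^ Suc i)) = ennreal e"
        using \<open>0 < e\<close> sums_mult[OF power_half_series, of e] by (intro suminf_ennreal_eq) auto
      finally show "outer_mass X \<sigma> (\<Union>i. A i) \<le> (\<Sum>i. outer_mass X \<sigma> (A i)) + ennreal e" .
    qed
  qed
qed

context
  assumes disjoint_add: "\<And>K L. closedin X K \<Longrightarrow> closedin X L \<Longrightarrow> K \<inter> L = {} \<Longrightarrow> \<sigma> (K \<union> L) = \<sigma> K + \<sigma> L"
begin

text \<open>
  For an open set \<open>V\<close>, exhaust \<open>V \<inter> U\<close> by closed sets \<open>K\<close> and then the open set \<open>V - K\<close>,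
  which contains \<open>V - U\<close>, by closed sets \<open>L\<close>. As \<open>K\<close> and \<open>L\<close> are disjoint, their masses add
  up to at most the mass of \<open>V\<close>.
\<close>
lemma open_in_lambda_system:
  assumes U: "openin X U"
  shows "U \<in> lambda_system (topspace X) (Pow (topspace X)) (outer_mass X \<sigma>)"
proof -
  interpret algebra "topspace X" "Pow (topspace X)" by (rule algebra_Pow)
  have split: "outer_mass X \<sigma> (A \<inter> U) + outer_mass X \<sigma> (A - U) \<le> open_mass X \<sigma> V"
    if V: "openin X V" "A \<subseteq> V" for A V
  proof -
    have "outer_mass X \<sigma> (A \<inter> U) + outer_mass X \<sigma> (A - U) \<le> open_mass X \<sigma> (V \<inter> U) + outer_mass X \<sigma> (V - U)"
      using U V by (intro add_mono outer_mass_lower outer_mass_mono) auto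
    also have "\<dots> = (SUP K\<in>{K. closedin X K \<and> K \<subseteq> V \<inter> U}. ennreal (\<sigma> K) + outer_mass X \<sigma> (V - U))"
      unfolding open_mass_def by (intro ennreal_SUP_add_left[symmetric]) auto
    also have "\<dots> \<le> open_mass X \<sigma> V"
    proof (rule SUP_least, clarify)
      fix K assume K: "closedin X K" "K \<subseteq> V \<inter> U"
      have "ennreal (\<sigma> K) + outer_mass X \<sigma> (V - U) \<le> ennreal (\<sigma> K) + open_mass X \<sigma> (V - K)"
        using K V by (intro add_left_mono outer_mass_lower) auto
      also have "\<dots> = (SUP L\<in>{L. closedin X L \<and> L \<subseteq> V - K}. ennreal (\<sigma> K) + ennreal (\<sigma> L))"
        unfolding open_mass_def by (intro ennreal_SUP_add_right) auto
      also have "\<dots> \<le> open_mass X \<sigma> V"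
      proof (rule SUP_least, clarify)
        fix L assume L: "closedin X L" "L \<subseteq> V - K"
        then have "ennreal (\<sigma> K) + ennreal (\<sigma> L) = ennreal (\<sigma> (K \<union> L))"
        proof -
          have "\<sigma> (K \<union> L) = \<sigma> K + \<sigma> L" using K L by (intro disjoint_add) auto
          then show ?thesis using K L closed_capacityD(4)[OF \<sigma>] by simp
        qed
        also have "\<dots> \<le> open_mass X \<sigma> V"
          using K L by (intro open_mass_upper closedin_Un) auto
        finally show "ennreal (\<sigma> K) + ennreal (\<sigma> L) \<le> open_mass X \<sigma> V" .
      qed
      finally show "ennreal (\<sigma> K) + outer_mass X \<sigma> (V - U) \<le> open_mass X \<sigma> V" .
    qed
    finally show ?thesis .
  qed
  have "outer_mass X \<sigma> (A \<inter> U) + outer_mass X \<sigma> (A - U) = outer_mass X \<sigma> A"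
    if A: "A \<subseteq> topspace X" for A
  proof (rule antisym)
    show "outer_mass X \<sigma> (A \<inter> U) + outer_mass X \<sigma> (A - U) \<le> outer_mass X \<sigma> A"
      unfolding outer_mass_def[of _ _ A] using split by (auto intro!: INF_greatest)
    have "subadditive (Pow (topspace X)) (outer_mass X \<sigma>)"
      using outer_measure_outer_mass unfolding outer_measure_space_def
      by (auto intro: countably_subadditive_subadditive)
    then have "outer_mass X \<sigma> ((A \<inter> U) \<union> (A - U)) \<le> outer_mass X \<sigma> (A \<inter> U) + outer_mass X \<sigma> (A - U)"
      using A by (intro subadditiveD) auto
    then show "outer_mass X \<sigma> A \<le> outer_mass X \<sigma> (A \<inter> U) + outer_mass X \<sigma> (A - U)"
      by (simp add: Int_Diff_Un)
  qed
  then show ?thesis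
    unfolding lambda_system_eq using U openin_subset by auto
qed

lemma measure_of_additive_capacity:
  obtains \<mu> where "sets \<mu> = sets (borel_of X)"
    "\<And>A. A \<in> sets (borel_of X) \<Longrightarrow> emeasure \<mu> A = outer_mass X \<sigma> A"
proof -
  interpret P: sigma_algebra "topspace X" "Pow (topspace X)" by (rule sigma_algebra_Pow)
  let ?L = "lambda_system (topspace X) (Pow (topspace X)) (outer_mass X \<sigma>)"
  have L: "measure_space (topspace X) ?L (outer_mass X \<sigma>)"
    by (rule P.caratheodory_lemma[OF outer_measure_outer_mass])
  then interpret L: sigma_algebra "topspace X" ?L by (simp add: measure_space_def)
  have sub: "sets (borel_of X) \<subseteq> ?L"
    unfolding sets_borel_of using open_in_lambda_system by (intro L.sigma_sets_subset) auto
  define \<mu> where "\<mu> = measure_of (topspace X) (sets (borel_of X)) (outer_mass X \<sigma>)"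
  have sa: "sigma_algebra (topspace X) (sets (borel_of X))"
    using sets.sigma_algebra_axioms[of "borel_of X"] by simp
  have ms: "measure_space (topspace X) (sets (borel_of X)) (outer_mass X \<sigma>)"
    using L sub sa unfolding measure_space_def positive_def countably_additive_def by blast
  show thesis
  proof
    show *: "sets \<mu> = sets (borel_of X)"
      unfolding \<mu>_def using sa by (rule sigma_algebra.sets_measure_of_eq)
    show "emeasure \<mu> A = outer_mass X \<sigma> A" if "A \<in> sets (borel_of X)" for A
      unfolding \<mu>_def using that ms sa
      by (intro emeasure_measure_of_sigma) (auto simp: measure_space_def)
  qed
qed

end

end

text \<open>
  The measure is bounded by \<open>\<tau>\<close> through open sets only: minimization controls \<open>\<sigma>\<close> on closed
  sets, and the measure of an open set is the supremum of \<open>\<sigma>\<close> over its closed subsets.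
\<close>
lemma regular_measure_below_capacity:
  assumes X: "compact_space X" "Hausdorff_space X"
    and \<tau>: "closed_capacity X \<tau>" and top: "\<tau> (topspace X) = 1"
  obtains \<mu> where "\<mu> \<in> regular_prob_measures X"
    "\<And>U r. openin X U \<Longrightarrow> (\<And>K. closedin X K \<Longrightarrow> K \<subseteq> U \<Longrightarrow> \<tau> K \<le> r) \<Longrightarrow> measure \<mu> U \<le> r"
proof -
  obtain \<sigma> where \<sigma>: "closed_capacity X \<sigma>" "\<sigma> (topspace X) = \<tau> (topspace X)"
    "\<And>K. closedin X K \<Longrightarrow> \<sigma> K \<le> \<tau> K"
    "\<And>K L. closedin X K \<Longrightarrow> closedin X L \<Longrightarrow> \<sigma> (K \<union> L) + \<sigma> (K \<inter> L) = \<sigma> K + \<sigma> L"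
    using modular_capacity_below[OF \<tau>] by metis
  have "\<sigma> (K \<union> L) = \<sigma> K + \<sigma> L" if "closedin X K" "closedin X L" "K \<inter> L = {}" for K L
    using \<sigma>(4)[OF that(1,2)] that(3) closed_capacityD(1)[OF \<sigma>(1)] by simp
  then obtain \<mu> where \<mu>: "sets \<mu> = sets (borel_of X)"
    "\<And>A. A \<in> sets (borel_of X) \<Longrightarrow> emeasure \<mu> A = outer_mass X \<sigma> A"
    using measure_of_additive_capacity[OF X \<sigma>(1)] by metis
  have sp: "space \<mu> = topspace X"
    using sets_eq_imp_space_eq[OF \<mu>(1)] by simp
  have \<mu>_open: "emeasure \<mu> U = open_mass X \<sigma> U" if "openin X U" for U
    using that \<mu>(2)[OF openin_borel_of] by (simp add: outer_mass_open)
  have prob: "prob_space \<mu>"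
  proof
    have "open_mass X \<sigma> (topspace X) = 1"
      using open_mass_finite[OF X \<sigma>(1), of "topspace X"] open_mass_upper[of X "topspace X" "topspace X" \<sigma>]
      by (simp add: \<sigma>(2) top)
    then show "emeasure \<mu> (space \<mu>) = 1" by (simp add: sp \<mu>_open)
  qed
  interpret prob_space \<mu> by fact
  have "\<mu> \<in> regular_prob_measures X"
  proof (rule regular_prob_measuresI[OF X(1) prob \<mu>(1)])
    show "\<exists>U. openin X U \<and> A \<subseteq> U \<and> measure \<mu> U \<le> measure \<mu> A + e"
      if A: "A \<in> sets \<mu>" and "e > 0" for A e
    proof -
      have "outer_mass X \<sigma> A < emeasure \<mu> A + ennreal e"
        using A \<open>e > 0\<close>
        by (simp add: \<mu>(1) \<mu>(2)[symmetric] emeasure_eq_measure ennreal_less_iff flip: ennreal_plus)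
      then obtain U where U: "openin X U" "A \<subseteq> U" "open_mass X \<sigma> U < emeasure \<mu> A + ennreal e"
        unfolding outer_mass_def INF_less_iff by auto
      then have "measure \<mu> U < measure \<mu> A + e"
        using \<open>e > 0\<close> by (simp add: \<mu>_open[symmetric] emeasure_eq_measure ennreal_less_iff flip: ennreal_plus)
      with U show ?thesis by (auto intro: less_imp_le)
    qed
  qed
  moreover have "measure \<mu> U \<le> r"
    if U: "openin X U" and r: "\<And>K. closedin X K \<Longrightarrow> K \<subseteq> U \<Longrightarrow> \<tau> K \<le> r" for U r
  proof -
    have "0 \<le> r" using r[of "{}"] closed_capacityD(1)[OF \<tau>] by simp
    have "emeasure \<mu> U \<le> ennreal r"
      unfolding \<mu>_open[OF U] open_mass_def
      using \<sigma>(3) r by (auto intro!: SUP_least ennreal_leI intro: order_trans)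
    then show ?thesis using \<open>0 \<le> r\<close> by (simp add: emeasure_eq_measure)
  qed
  ultimately show thesis by (rule that)
qed

section \<open>Image measures and lifting of measures\<close>

context
  fixes X :: "'x topology" and Y :: "'y topology" and \<phi> :: "'x \<Rightarrow> 'y"
  assumes X: "compact_space X" "Hausdorff_space X"
    and Y: "compact_space Y" "Hausdorff_space Y"
    and \<phi>: "continuous_map X Y \<phi>"
begin

lemma measurable_regular:
  assumes "\<mu> \<in> regular_prob_measures X"
  shows "\<phi> \<in> measurable \<mu> (borel_of Y)"
  using continuous_map_borel_measurable[OF \<phi>] measurable_cong_sets[OF regular_prob_measuresD(2)[OF assms] refl]
  by blast

lemma measure_pushforward:
  assumes "\<mu> \<in> regular_prob_measures X" "B \<in> sets (borel_of Y)"
  shows "measure (pushforward Y \<phi> \<mu>) B = measure \<mu> {x \<in> topspace X. \<phi> x \<in> B}"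
proof -
  have "\<phi> -` B \<inter> space \<mu> = {x \<in> topspace X. \<phi> x \<in> B}"
    using regular_prob_measuresD(3)[OF assms(1)] by auto
  then show ?thesis
    using measurable_regular[OF assms(1)] assms(2) by (simp add: pushforward_def measure_distr)
qed

text \<open>
  The image under \<open>\<phi>\<close> of a compact set that fills most of the preimage of the complement of
  \<open>B\<close> is compact, and its complement is the required open superset of \<open>B\<close>.
\<close>
lemma pushforward_regular:
  assumes \<mu>: "\<mu> \<in> regular_prob_measures X"
  shows "pushforward Y \<phi> \<mu> \<in> regular_prob_measures Y"
proof -
  interpret prob_space \<mu> using \<mu> by (rule regular_prob_measuresD)
  have prob: "prob_space (pushforward Y \<phi> \<mu>)"
    unfolding pushforward_def using measurable_regular[OF \<mu>] by (rule prob_space_distr)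
  interpret p: prob_space "pushforward Y \<phi> \<mu>" by fact
  have sets: "sets (pushforward Y \<phi> \<mu>) = sets (borel_of Y)"
    and space: "space (pushforward Y \<phi> \<mu>) = topspace Y" by (auto simp: pushforward_def)
  show ?thesis
  proof (rule regular_prob_measuresI[OF Y(1) prob sets])
    show "\<exists>U. openin Y U \<and> B \<subseteq> U \<and> measure (pushforward Y \<phi> \<mu>) U \<le> measure (pushforward Y \<phi> \<mu>) B + e"
      if B: "B \<in> sets (pushforward Y \<phi> \<mu>)" and "e > 0" for B e
    proof -
      let ?N = "topspace Y - B"
      have Bs: "B \<in> sets (borel_of Y)" "B \<subseteq> topspace Y"
        using B sets sets.sets_into_space[OF B] space by auto
      have N: "?N \<in> sets (borel_of Y)" using sets.compl_sets[OF Bs(1)] by simp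
      have "{x \<in> topspace X. \<phi> x \<in> ?N} = \<phi> -` ?N \<inter> space \<mu>"
        using regular_prob_measuresD(3)[OF \<mu>] by auto
      then have preN: "{x \<in> topspace X. \<phi> x \<in> ?N} \<in> sets \<mu>"
        using measurable_sets[OF measurable_regular[OF \<mu>] N] by simp
      obtain K where K: "compactin X K" "K \<subseteq> {x \<in> topspace X. \<phi> x \<in> ?N}"
        "measure \<mu> {x \<in> topspace X. \<phi> x \<in> ?N} \<le> measure \<mu> K + e"
        by (rule regular_prob_measures_inner[OF \<mu> preN \<open>e > 0\<close>])
      have cl: "closedin Y (\<phi> ` K)"
        using image_compactin[OF K(1) \<phi>] Y compactin_imp_closedin by blast
      define U where "U = topspace Y - \<phi> ` K"
      have U: "openin Y U" "B \<subseteq> U" using cl K(2) Bs by (auto simp: U_def)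
      have \<phi>K: "\<phi> ` K \<in> sets (borel_of Y)" "{x \<in> topspace X. \<phi> x \<in> \<phi> ` K} \<in> sets \<mu>"
      proof -
        show *: "\<phi> ` K \<in> sets (borel_of Y)" using cl by (rule closedin_borel_of)
        have "{x \<in> topspace X. \<phi> x \<in> \<phi> ` K} = \<phi> -` (\<phi> ` K) \<inter> space \<mu>"
          using regular_prob_measuresD(3)[OF \<mu>] by auto
        then show "{x \<in> topspace X. \<phi> x \<in> \<phi> ` K} \<in> sets \<mu>"
          using measurable_sets[OF measurable_regular[OF \<mu>] *] by simp
      qed
      have "measure (pushforward Y \<phi> \<mu>) ?N \<le> measure \<mu> K + e"
        using K(3) by (simp add: measure_pushforward[OF \<mu> N])
      also have "measure \<mu> K \<le> measure (pushforward Y \<phi> \<mu>) (\<phi> ` K)"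
        unfolding measure_pushforward[OF \<mu> \<phi>K(1)] using K(2) \<phi>K(2) by (intro finite_measure_mono) auto
      finally have "1 - measure (pushforward Y \<phi> \<mu>) B \<le> (1 - measure (pushforward Y \<phi> \<mu>) U) + e"
        using p.prob_compl[OF B] p.prob_compl[of "\<phi> ` K"] \<phi>K(1) sets unfolding U_def space by simp
      then show ?thesis using U by auto
    qed
  qed
qed

lemma continuous_map_pushforward:
  "continuous_map (prob_measures_topology X) (prob_measures_topology Y) (pushforward Y \<phi>)"
proof -
  have "openin (prob_measures_topology X)
          (pushforward Y \<phi> -` {\<nu> \<in> regular_prob_measures Y. (\<integral>y. f y \<partial>\<nu>) \<in> V} \<inter> regular_prob_measures X)"
    if f: "continuous_map Y euclideanreal f" and V: "open V" for f V
  proof -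
    have "integral\<^sup>L (pushforward Y \<phi> \<mu>) f = (\<integral>x. (f \<circ> \<phi>) x \<partial>\<mu>)"
      if "\<mu> \<in> regular_prob_measures X" for \<mu>
      using integral_distr[OF measurable_regular[OF that] continuous_real_borel_measurable[OF f]]
      by (simp add: pushforward_def)
    then have "pushforward Y \<phi> -` {\<nu> \<in> regular_prob_measures Y. (\<integral>y. f y \<partial>\<nu>) \<in> V} \<inter> regular_prob_measures X
      = {\<mu> \<in> regular_prob_measures X. (\<integral>x. (f \<circ> \<phi>) x \<partial>\<mu>) \<in> V}"
      using pushforward_regular by auto
    moreover have "continuous_map X euclideanreal (f \<circ> \<phi>)"
      using continuous_map_compose[OF \<phi> f] .
    ultimately show ?thesis
      unfolding prob_measures_topology_def using V
      by (intro topology_generated_by_Basis) (auto simp del: o_apply)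
  qed
  moreover have "pushforward Y \<phi> ` regular_prob_measures X \<subseteq> topspace (prob_measures_topology Y)"
    using pushforward_regular by (auto simp: topspace_prob_measures_topology)
  ultimately show ?thesis
    unfolding prob_measures_topology_def[of Y]
    by (intro continuous_on_generated_topo)
       (auto simp only: topspace_prob_measures_topology topology_generated_by_topspace)
qed

text \<open>
  The functions \<open>c i * indicator (E i)\<close> split \<open>\<nu>\<close> into pieces, and the piece with index \<open>i\<close> is
  to be lifted into \<open>A i\<close>, which is possible because it lives on \<open>\<phi> ` A i\<close>. All pieces are
  lifted at once by the capacity \<open>\<tau>\<close> that sends \<open>K\<close> to the sum of the masses that the pieces
  give to \<open>\<phi> ` (K \<inter> A i)\<close>. A measure below \<open>\<tau>\<close> has image at most \<open>\<nu>\<close>, hence equal to \<open>\<nu>\<close>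
  as both have total mass 1; and off \<open>A i\<close> the capacity loses the whole piece \<open>i\<close>, so the
  measure has at least the mass of that piece on \<open>A i\<close>.
\<close>
lemma lift_measure:
  fixes A :: "'i \<Rightarrow> 'x set" and E :: "'i \<Rightarrow> 'y set" and c :: "'i \<Rightarrow> real"
  assumes \<nu>: "\<nu> \<in> regular_prob_measures Y"
    and I: "finite I"
    and A: "\<And>i. i \<in> I \<Longrightarrow> closedin X (A i)"
    and E: "\<And>i. i \<in> I \<Longrightarrow> E i \<in> sets (borel_of Y)" "\<And>i. i \<in> I \<Longrightarrow> E i \<subseteq> \<phi> ` A i"
    and c: "\<And>i. i \<in> I \<Longrightarrow> 0 \<le> c i"
    and unity: "\<And>y. y \<in> topspace Y \<Longrightarrow> (\<Sum>i\<in>I. c i * indicator (E i) y) = 1"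
  obtains \<mu> where "\<mu> \<in> regular_prob_measures X" "pushforward Y \<phi> \<mu> = \<nu>"
    "\<forall>i\<in>I. c i * measure \<nu> (E i) \<le> measure \<mu> (A i)"
proof -
  interpret prob_space \<nu> using \<nu> by (rule regular_prob_measuresD)
  have sets: "sets \<nu> = sets (borel_of Y)" and space: "space \<nu> = topspace Y"
    using regular_prob_measuresD[OF \<nu>] by auto
  define m where "m i B = c i * measure \<nu> (B \<inter> E i)" for i B
  have sum_m: "(\<Sum>i\<in>I. m i B) = measure \<nu> B" if B: "B \<in> sets \<nu>" for B
  proof -
    have BE: "B \<inter> E i \<in> sets \<nu>" if "i \<in> I" for i using B E sets that by auto
    have "(\<Sum>i\<in>I. m i B) = (\<Sum>i\<in>I. \<integral>y. c i * indicator (B \<inter> E i) y \<partial>\<nu>)"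
      using BE by (intro sum.cong refl) (simp add: m_def)
    also have "\<dots> = (\<integral>y. (\<Sum>i\<in>I. c i * indicator (B \<inter> E i) y) \<partial>\<nu>)"
      using BE by (intro Bochner_Integration.integral_sum[symmetric])
        (auto intro!: integrable_mult_right integrable_real_indicator simp: emeasure_eq_measure)
    also have "\<dots> = (\<integral>y. indicator B y \<partial>\<nu>)"
    proof (rule Bochner_Integration.integral_cong[OF refl])
      fix y assume "y \<in> space \<nu>"
      then show "(\<Sum>i\<in>I. c i * indicator (B \<inter> E i) y) = (indicator B y :: real)"
        using unity[of y] space by (cases "y \<in> B") (auto simp: indicator_def)
    qed
    also have "\<dots> = measure \<nu> B" using B by simp
    finally show ?thesis .
  qed
  have m_mono: "m i B \<le> m i C" if "i \<in> I" "B \<subseteq> C" "C \<in> sets \<nu>" for i B C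
    unfolding m_def using that c E sets by (intro mult_left_mono finite_measure_mono) auto
  have closed: "closedin Y (\<phi> ` (K \<inter> A i))" if "closedin X K" "i \<in> I" for K i
    using continuous_imp_closed_map[OF \<phi> X(1) Y(2)] A that by (auto simp: closed_map_def closedin_Int)
  then have in_sets: "\<phi> ` (K \<inter> A i) \<in> sets \<nu>" if "closedin X K" "i \<in> I" for K i
    using that closedin_borel_of sets by blast
  define \<tau> where "\<tau> K = (\<Sum>i\<in>I. m i (\<phi> ` (K \<inter> A i)))" for K
  have cap: "closed_capacity X \<tau>"
    unfolding closed_capacity_def
  proof (intro conjI allI impI)
    show "\<tau> {} = 0" by (simp add: \<tau>_def m_def)
    fix K L assume K: "closedin X K" and L: "closedin X L"
    show "\<tau> K \<le> \<tau> L" if "K \<subseteq> L"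
      unfolding \<tau>_def using that L by (intro sum_mono m_mono in_sets) auto
    have "m i (\<phi> ` ((K \<union> L) \<inter> A i)) + m i (\<phi> ` ((K \<inter> L) \<inter> A i)) \<le> m i (\<phi> ` (K \<inter> A i)) + m i (\<phi> ` (L \<inter> A i))"
      if i: "i \<in> I" for i
    proof -
      let ?P = "\<phi> ` (K \<inter> A i)" and ?Q = "\<phi> ` (L \<inter> A i)"
      have PQ: "?P \<in> sets \<nu>" "?Q \<in> sets \<nu>" "E i \<in> sets \<nu>"
        using in_sets K L i E sets by auto
      have "m i (\<phi> ` ((K \<union> L) \<inter> A i)) + m i (\<phi> ` ((K \<inter> L) \<inter> A i)) \<le> m i (?P \<union> ?Q) + m i (?P \<inter> ?Q)"
        using PQ i by (intro add_mono m_mono) auto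
      also have "\<dots> = m i ?P + m i ?Q"
      proof -
        have "(?P \<union> ?Q) \<inter> E i = (?P \<inter> E i) \<union> (?Q \<inter> E i)" "(?P \<inter> ?Q) \<inter> E i = (?P \<inter> E i) \<inter> (?Q \<inter> E i)"
          by auto
        then show ?thesis
          using measure_Un3[of "?P \<inter> E i" \<nu> "?Q \<inter> E i"] PQ
          by (simp add: m_def fmeasurable_eq_sets flip: distrib_left)
      qed
      finally show ?thesis .
    qed
    then show "\<tau> (K \<union> L) + \<tau> (K \<inter> L) \<le> \<tau> K + \<tau> L"
      unfolding \<tau>_def by (simp add: sum_mono flip: sum.distrib)
  qed
  have m_top: "m i (\<phi> ` A i) = m i (topspace Y)" if "i \<in> I" for i
  proof -
    have "\<phi> ` A i \<inter> E i = topspace Y \<inter> E i"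
      using E(2)[OF that] sets.sets_into_space[OF E(1)[OF that]] by auto
    then show ?thesis by (simp add: m_def)
  qed
  have top: "\<tau> (topspace X) = 1"
  proof -
    have "\<tau> (topspace X) = (\<Sum>i\<in>I. m i (topspace Y))"
      unfolding \<tau>_def
    proof (rule sum.cong[OF refl])
      fix i assume i: "i \<in> I"
      then have "topspace X \<inter> A i = A i" using closedin_subset[OF A[OF i]] by auto
      then show "m i (\<phi> ` (topspace X \<inter> A i)) = m i (topspace Y)" using m_top[OF i] by simp
    qed
    then show ?thesis using sum_m[of "topspace Y"] sets.top[of \<nu>] prob_space space by simp
  qed
  obtain \<mu> where \<mu>: "\<mu> \<in> regular_prob_measures X"
    and \<mu>le: "\<And>U r. openin X U \<Longrightarrow> (\<And>K. closedin X K \<Longrightarrow> K \<subseteq> U \<Longrightarrow> \<tau> K \<le> r) \<Longrightarrow> measure \<mu> U \<le> r"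
    using regular_measure_below_capacity[OF X cap top] by metis
  interpret \<mu>: prob_space \<mu> using \<mu> by (rule regular_prob_measuresD)
  have push: "pushforward Y \<phi> \<mu> \<in> regular_prob_measures Y"
    by (rule pushforward_regular[OF \<mu>])
  interpret p: prob_space "pushforward Y \<phi> \<mu>" using push by (rule regular_prob_measuresD)
  have psets: "sets (pushforward Y \<phi> \<mu>) = sets \<nu>" by (simp add: pushforward_def sets)
  have open_le: "measure (pushforward Y \<phi> \<mu>) G \<le> measure \<nu> G" if G: "openin Y G" for G
    unfolding measure_pushforward[OF \<mu> openin_borel_of[OF G]]
  proof (rule \<mu>le)
    show "openin X {x \<in> topspace X. \<phi> x \<in> G}"
      using openin_continuous_map_preimage[OF \<phi> G] .
    fix K assume K: "closedin X K" "K \<subseteq> {x \<in> topspace X. \<phi> x \<in> G}"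
    have Gs: "G \<in> sets \<nu>" using G openin_borel_of sets by blast
    have "\<tau> K \<le> (\<Sum>i\<in>I. m i G)"
      unfolding \<tau>_def using K Gs by (intro sum_mono m_mono) auto
    then show "\<tau> K \<le> measure \<nu> G" using sum_m[OF Gs] by simp
  qed
  \<comment> \<open>Outer regularity of \<open>\<nu>\<close> extends the inequality to Borel sets; complements reverse
    it.\<close>
  have le: "measure (pushforward Y \<phi> \<mu>) B \<le> measure \<nu> B" if B: "B \<in> sets \<nu>" for B
  proof (rule field_le_epsilon)
    fix e :: real assume "0 < e"
    then obtain G where G: "openin Y G" "B \<subseteq> G" "measure \<nu> G \<le> measure \<nu> B + e"
      using regular_prob_measures_outer[OF \<nu> B] by metis
    have "G \<in> sets (pushforward Y \<phi> \<mu>)" using G(1) openin_borel_of sets psets by blast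
    then have "measure (pushforward Y \<phi> \<mu>) B \<le> measure (pushforward Y \<phi> \<mu>) G"
      using G(2) by (intro p.finite_measure_mono)
    then show "measure (pushforward Y \<phi> \<mu>) B \<le> measure \<nu> B + e"
      using open_le[OF G(1)] G(3) by linarith
  qed
  have "pushforward Y \<phi> \<mu> = \<nu>"
  proof (rule measure_eqI[OF psets])
    fix B assume B: "B \<in> sets (pushforward Y \<phi> \<mu>)"
    have "measure (pushforward Y \<phi> \<mu>) (topspace Y - B) \<le> measure \<nu> (topspace Y - B)"
      using le B psets sets.compl_sets[of B \<nu>] space by simp
    then have "measure (pushforward Y \<phi> \<mu>) B = measure \<nu> B"
      using p.prob_compl[OF B] prob_compl[of B] le[of B] B psets space
      by (simp add: regular_prob_measuresD(3)[OF push])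
    then show "emeasure (pushforward Y \<phi> \<mu>) B = emeasure \<nu> B"
      by (simp add: p.emeasure_eq_measure emeasure_eq_measure)
  qed
  moreover have "c i * measure \<nu> (E i) \<le> measure \<mu> (A i)" if i: "i \<in> I" for i
  proof -
    have Y1: "measure \<nu> (topspace Y) = 1" using prob_space space by simp
    have mi: "m i (topspace Y) = c i * measure \<nu> (E i)"
      using sets.sets_into_space[OF E(1)[OF i]] by (simp add: m_def Int_absorb1)
    have "measure \<mu> (topspace X - A i) \<le> 1 - m i (topspace Y)"
    proof (rule \<mu>le)
      show "openin X (topspace X - A i)" using A[OF i] by auto
      fix K assume K: "closedin X K" "K \<subseteq> topspace X - A i"
      then have "K \<inter> A i = {}" by auto
      then have "\<tau> K = (\<Sum>j\<in>I - {i}. m j (\<phi> ` (K \<inter> A j)))"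
        unfolding \<tau>_def using I i by (subst sum.remove[of I i]) (auto simp: m_def)
      also have "\<dots> \<le> (\<Sum>j\<in>I - {i}. m j (topspace Y))"
        using closedin_subset[OF closed[OF K(1)]] sets.top[of \<nu>] space
        by (intro sum_mono m_mono) auto
      also have "\<dots> = 1 - m i (topspace Y)"
        using sum_m[of "topspace Y"] sets.top[of \<nu>] space Y1 I i
        by (simp add: sum.remove[of I i])
      finally show "\<tau> K \<le> 1 - m i (topspace Y)" .
    qed
    moreover have "A i \<in> sets \<mu>"
      using closedin_borel_of[OF A[OF i]] regular_prob_measuresD(2)[OF \<mu>] by simp
    ultimately show ?thesis
      using \<mu>.prob_compl[of "A i"] mi by (simp add: regular_prob_measuresD(3)[OF \<mu>])
  qed
  ultimately show thesis using \<mu> that by blast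
qed

end

section \<open>Neighbourhoods described by the masses of finitely many sets\<close>

text \<open>
  One-sided inequalities suffice, because \<open>J\<close> may contain \<open>f\<close> together with \<open>- f\<close>.
\<close>
lemma prob_measures_basic_neighbourhood:
  assumes "openin (prob_measures_topology X) \<U>" "\<mu>0 \<in> \<U>"
  obtains J e where "finite J" "\<And>f. f \<in> J \<Longrightarrow> continuous_map X euclideanreal f" "e > 0"
    "\<And>\<mu>. \<mu> \<in> regular_prob_measures X \<Longrightarrow> (\<And>f. f \<in> J \<Longrightarrow> (\<integral>x. f x \<partial>\<mu>0) - e < (\<integral>x. f x \<partial>\<mu>)) \<Longrightarrow> \<mu> \<in> \<U>"
proof -
  let ?S = "{{\<mu> \<in> regular_prob_measures X. (\<integral>x. f x \<partial>\<mu>) \<in> V} | f V.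
        continuous_map X euclideanreal f \<and> open V}"
  let ?nbhd = "\<lambda>J e. {\<mu> \<in> regular_prob_measures X. \<forall>f\<in>J. (\<integral>x. f x \<partial>\<mu>0) - e < (\<integral>x. f x \<partial>\<mu>)}"
  have "generate_topology_on ?S \<U>"
    using assms(1) unfolding prob_measures_topology_def by (rule openin_topology_generated_by)
  then have "\<exists>J e. finite J \<and> (\<forall>f\<in>J. continuous_map X euclideanreal f) \<and> e > 0 \<and> ?nbhd J e \<subseteq> \<U>"
    using assms(2)
  proof induction
    case (Int \<U> \<V>)
    then obtain J e K d where
      J: "finite J" "\<forall>f\<in>J. continuous_map X euclideanreal f" "e > 0" "?nbhd J e \<subseteq> \<U>" and
      K: "finite K" "\<forall>f\<in>K. continuous_map X euclideanreal f" "d > 0" "?nbhd K d \<subseteq> \<V>"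
      by auto
    have "?nbhd (J \<union> K) (min e d) \<subseteq> ?nbhd J e \<inter> ?nbhd K d"
    proof (intro subsetI IntI CollectI conjI ballI)
      fix \<mu> assume "\<mu> \<in> ?nbhd (J \<union> K) (min e d)"
      then have \<mu>: "\<mu> \<in> regular_prob_measures X"
        "\<And>f. f \<in> J \<union> K \<Longrightarrow> (\<integral>x. f x \<partial>\<mu>0) - min e d < (\<integral>x. f x \<partial>\<mu>)" by blast+
      show "\<mu> \<in> regular_prob_measures X" "\<mu> \<in> regular_prob_measures X" by fact+
      show "(\<integral>x. f x \<partial>\<mu>0) - e < (\<integral>x. f x \<partial>\<mu>)" if "f \<in> J" for f
        using \<mu>(2)[of f] that by simp
      show "(\<integral>x. f x \<partial>\<mu>0) - d < (\<integral>x. f x \<partial>\<mu>)" if "f \<in> K" for f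
        using \<mu>(2)[of f] that by simp
    qed
    with J K show ?case
      by (intro exI[of _ "J \<union> K"] exI[of _ "min e d"]) auto
  next
    case (UN \<K>)
    then show ?case by (meson UnionE Union_upper order_trans)
  next
    case (Basis s)
    then obtain f V where fV: "continuous_map X euclideanreal f" "open V"
      "s = {\<mu> \<in> regular_prob_measures X. (\<integral>x. f x \<partial>\<mu>) \<in> V}" "(\<integral>x. f x \<partial>\<mu>0) \<in> V" by auto
    then obtain e where e: "e > 0" "\<And>r. \<bar>r - (\<integral>x. f x \<partial>\<mu>0)\<bar> < e \<Longrightarrow> r \<in> V"
      unfolding open_dist by (auto simp: dist_real_def)
    have "?nbhd {f, \<lambda>x. - f x} e \<subseteq> s"
      using e fV(3) by (auto simp: abs_if)
    then show ?case using fV(1) e(1)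
      by (intro exI[of _ "{f, \<lambda>x. - f x}"] exI[of _ e]) (auto intro: continuous_map_minus)
  qed auto
  then obtain J e where J: "finite J" "\<forall>f\<in>J. continuous_map X euclideanreal f" "e > 0" "?nbhd J e \<subseteq> \<U>"
    by (elim exE conjE)
  show thesis
  proof (rule that[of J e])
    show "\<mu> \<in> \<U>" if "\<mu> \<in> regular_prob_measures X"
      "\<And>f. f \<in> J \<Longrightarrow> (\<integral>x. f x \<partial>\<mu>0) - e < (\<integral>x. f x \<partial>\<mu>)" for \<mu>
      using J(4) that by blast
  qed (use J in auto)
qed

lemma finite_common_bound:
  assumes "compact_space X" "finite J" "\<And>f. f \<in> J \<Longrightarrow> continuous_map X euclideanreal f"
  obtains M :: real where "M > 0" "\<And>f x. f \<in> J \<Longrightarrow> x \<in> topspace X \<Longrightarrow> \<bar>f x\<bar> \<le> M"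
proof -
  have "\<forall>f\<in>J. \<exists>M>0. \<forall>x\<in>topspace X. \<bar>f x\<bar> \<le> M"
    using continuous_real_bounded[OF assms(1) assms(3)] by metis
  then obtain m where m: "\<forall>f\<in>J. m f > 0 \<and> (\<forall>x\<in>topspace X. \<bar>f x\<bar> \<le> m f)"
    by metis
  have "m f \<le> 1 + (\<Sum>g\<in>J. m g)" if "f \<in> J" for f
    using member_le_sum[OF that, of m] m assms(2) by fastforce
  moreover have "0 \<le> (\<Sum>g\<in>J. m g)" using m by (intro sum_nonneg) auto
  ultimately show thesis
    using m by (intro that[of "1 + (\<Sum>g\<in>J. m g)"]) (auto intro: order_trans)
qed

text \<open>
  Rounding the values of the functions in \<open>J\<close> to multiples of \<open>\<eta>\<close> partitions \<open>X\<close> into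
  finitely many Borel sets, and \<open>s\<close> moves every point to a representative of its class.
\<close>
lemma finite_retraction_small_oscillation:
  assumes X: "compact_space X" and J: "finite J" "\<And>f. f \<in> J \<Longrightarrow> continuous_map X euclideanreal f"
    and "\<eta> > 0"
  obtains s where "finite (s ` topspace X)" "s ` topspace X \<subseteq> topspace X"
    "\<forall>f\<in>J. \<forall>x\<in>topspace X. \<bar>f x - f (s x)\<bar> < \<eta>"
    "\<forall>p\<in>s ` topspace X. {x \<in> topspace X. s x = p} \<in> sets (borel_of X)"
proof -
  obtain M where M: "M > 0" "\<And>f x. f \<in> J \<Longrightarrow> x \<in> topspace X \<Longrightarrow> \<bar>f x\<bar> \<le> M"
    using finite_common_bound[OF X J] by metis
  define F where "F x = (\<lambda>f. if f \<in> J then \<lfloor>f x / \<eta>\<rfloor> else 0)" for x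
  have "F ` topspace X \<subseteq> {g. \<forall>f. (f \<in> J \<longrightarrow> g f \<in> {\<lfloor>- (M / \<eta>)\<rfloor>..\<lfloor>M / \<eta>\<rfloor>}) \<and> (f \<notin> J \<longrightarrow> g f = 0)}"
  proof clarify
    fix x f assume x: "x \<in> topspace X"
    show "(f \<in> J \<longrightarrow> F x f \<in> {\<lfloor>- (M / \<eta>)\<rfloor>..\<lfloor>M / \<eta>\<rfloor>}) \<and> (f \<notin> J \<longrightarrow> F x f = 0)"
    proof (cases "f \<in> J")
      case True
      then have "- M \<le> f x" "f x \<le> M" using M(2)[OF True x] by (auto simp: abs_le_iff)
      then have "- M / \<eta> \<le> f x / \<eta>" "f x / \<eta> \<le> M / \<eta>"
        using \<open>\<eta> > 0\<close> by (intro divide_right_mono; simp)+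
      then show ?thesis using True by (auto simp: F_def intro!: floor_mono)
    qed (simp add: F_def)
  qed
  then have fin: "finite (F ` topspace X)"
    by (rule finite_subset) (intro finite_set_of_finite_funs J(1) finite_atLeastAtMost_int)
  \<comment> \<open>As \<open>s x\<close> depends on \<open>F x\<close> only, \<open>s\<close> is constant on each
    class.\<close>
  define s where "s x = inv_into (topspace X) F (F x)" for x
  have s: "s x \<in> topspace X" "F (s x) = F x" if "x \<in> topspace X" for x
    using that by (simp_all add: s_def inv_into_into f_inv_into_f)
  have "finite (s ` topspace X)"
    using finite_imageI[OF fin, of "inv_into (topspace X) F"] by (simp add: s_def image_image)
  moreover have "\<bar>f x - f (s x)\<bar> < \<eta>" if "f \<in> J" "x \<in> topspace X" for f x
  proof -
    have "\<lfloor>f x / \<eta>\<rfloor> = \<lfloor>f (s x) / \<eta>\<rfloor>"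
      using fun_cong[OF s(2)[OF that(2)], of f] that(1) by (simp add: F_def)
    then have "\<bar>f x / \<eta> - f (s x) / \<eta>\<bar> < 1" by linarith
    then have "\<bar>(f x - f (s x)) / \<eta>\<bar> < 1" by (simp add: diff_divide_distrib)
    then show ?thesis using \<open>\<eta> > 0\<close> by (simp add: abs_divide)
  qed
  moreover have "{x \<in> topspace X. s x = p} \<in> sets (borel_of X)" if p: "p \<in> s ` topspace X" for p
  proof -
    have eq: "{x \<in> topspace X. s x = p} = {x \<in> space (borel_of X). \<forall>f\<in>J. \<lfloor>f x / \<eta>\<rfloor> = \<lfloor>f p / \<eta>\<rfloor>}"
    proof -
      have "s x = p \<longleftrightarrow> F x = F p" if "x \<in> topspace X" for x
      proof
        assume "F x = F p"
        moreover from p obtain w where w: "w \<in> topspace X" "p = s w" by auto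
        ultimately have "F x = F w" using s by simp
        then show "s x = p" by (simp add: s_def w)
      qed (use that s(2) in force)
      moreover have "F x = F p \<longleftrightarrow> (\<forall>f\<in>J. \<lfloor>f x / \<eta>\<rfloor> = \<lfloor>f p / \<eta>\<rfloor>)" for x
        by (auto simp: F_def fun_eq_iff)
      ultimately show ?thesis by auto
    qed
    have "{x \<in> space (borel_of X). \<lfloor>f x / \<eta>\<rfloor> = k} \<in> sets (borel_of X)" if f: "f \<in> J" for f k
    proof -
      have "\<lfloor>r / \<eta>\<rfloor> = k \<longleftrightarrow> r \<in> {k * \<eta>..<(k + 1) * \<eta>}" for r
        using \<open>\<eta> > 0\<close> by (simp add: floor_eq_iff pos_le_divide_eq pos_divide_less_eq)
      then have "{x \<in> space (borel_of X). \<lfloor>f x / \<eta>\<rfloor> = k} = f -` {k * \<eta>..<(k + 1) * \<eta>} \<inter> space (borel_of X)"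
        by blast
      also have "\<dots> \<in> sets (borel_of X)"
        using continuous_real_borel_measurable[OF J(2)[OF f]] by (rule measurable_sets) simp
      finally show ?thesis .
    qed
    then show ?thesis unfolding eq
      by (intro sets.sets_Collect_finite_All J(1))
  qed
  ultimately show thesis using s(1) by (intro that[of s]) auto
qed

text \<open>
  Lower bounds for the masses of disjoint sets bound \<open>\<integral>f d\<mu>\<close> from below once \<open>f\<close> is made
  nonnegative, so the estimate is carried out for \<open>f + M\<close>, which lies between 0 and \<open>2 * M\<close>.
\<close>
lemma integral_lower_bound_by_masses:
  fixes f :: "'a \<Rightarrow> real" and M \<eta> \<delta> :: real
  assumes X: "compact_space X" and \<mu>: "\<mu> \<in> regular_prob_measures X"
    and f: "continuous_map X euclideanreal f" and M: "\<And>x. x \<in> topspace X \<Longrightarrow> \<bar>f x\<bar> \<le> M"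
    and P: "finite P" "P \<subseteq> topspace X"
    and A: "\<And>p. p \<in> P \<Longrightarrow> A p \<in> sets (borel_of X)" "disjoint_family_on A P"
    and osc: "\<And>p x. p \<in> P \<Longrightarrow> x \<in> A p \<Longrightarrow> f p - \<eta> \<le> f x" and "\<eta> \<ge> 0"
    and a: "sum a P = 1" "\<And>p. p \<in> P \<Longrightarrow> a p - \<delta> \<le> measure \<mu> (A p)" and "\<delta> \<ge> 0"
  shows "(\<Sum>p\<in>P. a p * f p) - \<eta> - 2 * M * (card P * \<delta>) \<le> (\<integral>x. f x \<partial>\<mu>)"
proof -
  interpret prob_space \<mu> using \<mu> by (rule regular_prob_measuresD)
  have sets: "sets \<mu> = sets (borel_of X)" and space: "space \<mu> = topspace X"
    using regular_prob_measuresD[OF \<mu>] by auto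
  have A': "A p \<in> sets \<mu>" if "p \<in> P" for p using A(1) that sets by simp
  have int: "integrable \<mu> (\<lambda>x. (f p + M) * indicator (A p) x)" if "p \<in> P" for p
    using A'[OF that] by (intro integrable_mult_right integrable_real_indicator) (auto simp: emeasure_eq_measure)
  have fM: "0 \<le> f p + M" "f p + M \<le> 2 * M" if "p \<in> P" for p
    using M[of p] that P(2) by (auto simp: abs_le_iff)
  have "(\<Sum>p\<in>P. (f p + M) * measure \<mu> (A p)) - (M + \<eta>) = (\<integral>x. (\<Sum>p\<in>P. (f p + M) * indicator (A p) x) - (M + \<eta>) \<partial>\<mu>)"
    using int A' by (simp add: Bochner_Integration.integral_diff prob_space Bochner_Integration.integral_sum)
  also have "\<dots> \<le> (\<integral>x. f x \<partial>\<mu>)"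
  proof (rule integral_mono)
    show "integrable \<mu> (\<lambda>x. (\<Sum>p\<in>P. (f p + M) * indicator (A p) x) - (M + \<eta>))"
      using int by (intro Bochner_Integration.integrable_diff Bochner_Integration.integrable_sum) auto
    show "integrable \<mu> f" by (rule continuous_real_integrable[OF X \<mu> f])
    fix x assume "x \<in> space \<mu>"
    then have x: "x \<in> topspace X" by (simp add: space)
    show "(\<Sum>p\<in>P. (f p + M) * indicator (A p) x) - (M + \<eta>) \<le> f x"
    proof (cases "\<exists>p\<in>P. x \<in> A p")
      case True
      then obtain p where p: "p \<in> P" "x \<in> A p" by blast
      have "x \<notin> A q" if "q \<in> P - {p}" for q
        using A(2) p that by (auto simp: disjoint_family_on_def)
      then have "(\<Sum>q\<in>P. (f q + M) * indicator (A q) x) = f p + M"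
        using p P(1) by (subst sum.remove[OF P(1) p(1)]) (auto intro!: sum.neutral)
      then show ?thesis using osc[OF p] by simp
    next
      case False
      then have "(\<Sum>q\<in>P. (f q + M) * indicator (A q) x) = 0"
        by (intro sum.neutral) auto
      then show ?thesis using M[OF x] \<open>\<eta> \<ge> 0\<close> by (auto simp: abs_le_iff)
    qed
  qed
  finally have 1: "(\<Sum>p\<in>P. (f p + M) * measure \<mu> (A p)) - (M + \<eta>) \<le> (\<integral>x. f x \<partial>\<mu>)" .
  have "(f p + M) * a p - 2 * M * \<delta> \<le> (f p + M) * measure \<mu> (A p)" if p: "p \<in> P" for p
  proof -
    have "(f p + M) * (a p - \<delta>) \<le> (f p + M) * measure \<mu> (A p)"
      using a(2)[OF p] fM[OF p] by (intro mult_left_mono)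
    moreover have "(f p + M) * \<delta> \<le> 2 * M * \<delta>"
      using fM[OF p] \<open>\<delta> \<ge> 0\<close> by (intro mult_right_mono)
    ultimately show ?thesis by (simp add: algebra_simps)
  qed
  then have "(\<Sum>p\<in>P. (f p + M) * a p - 2 * M * \<delta>) \<le> (\<Sum>p\<in>P. (f p + M) * measure \<mu> (A p))"
    by (rule sum_mono)
  moreover have "(\<Sum>p\<in>P. (f p + M) * a p - 2 * M * \<delta>) = (\<Sum>p\<in>P. a p * f p) + M - 2 * M * (card P * \<delta>)"
  proof -
    have "(\<Sum>p\<in>P. (f p + M) * a p) = (\<Sum>p\<in>P. a p * f p) + M * sum a P"
      by (simp add: sum_distrib_left sum.distrib[symmetric] algebra_simps)
    then show ?thesis using a(1) by (simp add: sum_subtractf)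
  qed
  ultimately show ?thesis using 1 by linarith
qed

text \<open>
  The measure \<open>\<mu>0\<close> is close to the discrete measure with mass \<open>a p\<close> at \<open>p\<close>, where \<open>a p\<close> is the
  \<open>\<mu>0\<close>-mass of a class on which the relevant functions are nearly constant. Any measure with
  almost the mass \<open>a p\<close> on a small neighbourhood of each \<open>p\<close> is close to the same discrete
  measure. Only lower bounds for the masses are needed, since the \<open>a p\<close> add up to 1.
\<close>
lemma open_contains_mass_condition:
  assumes X: "compact_space X" "Hausdorff_space X"
    and \<U>: "openin (prob_measures_topology X) \<U>" "\<mu>0 \<in> \<U>"
  obtains P A a \<delta> where "finite P" "P \<subseteq> topspace X"
    "\<forall>p\<in>P. closedin X (A p) \<and> p \<in> X interior_of A p"
    "\<forall>p\<in>P. a p > (0::real)" "sum a P = 1" "\<delta> > 0"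
    "\<forall>\<mu>\<in>regular_prob_measures X. (\<forall>p\<in>P. a p - \<delta> \<le> measure \<mu> (A p)) \<longrightarrow> \<mu> \<in> \<U>"
proof -
  obtain J e where J: "finite J" "\<And>f. f \<in> J \<Longrightarrow> continuous_map X euclideanreal f" and "e > 0"
    and nbhd: "\<And>\<mu>. \<mu> \<in> regular_prob_measures X \<Longrightarrow>
        (\<And>f. f \<in> J \<Longrightarrow> (\<integral>x. f x \<partial>\<mu>0) - e < (\<integral>x. f x \<partial>\<mu>)) \<Longrightarrow> \<mu> \<in> \<U>"
    by (rule prob_measures_basic_neighbourhood[OF \<U>]; rule that; blast)
  have \<mu>0: "\<mu>0 \<in> regular_prob_measures X"
    using openin_subset[OF \<U>(1)] \<U>(2) by (auto simp: topspace_prob_measures_topology)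
  interpret prob_space \<mu>0 using \<mu>0 by (rule regular_prob_measuresD)
  have sets0: "sets \<mu>0 = sets (borel_of X)" and space0: "space \<mu>0 = topspace X"
    using regular_prob_measuresD[OF \<mu>0] by auto
  obtain M where M: "M > 0" "\<And>f x. f \<in> J \<Longrightarrow> x \<in> topspace X \<Longrightarrow> \<bar>f x\<bar> \<le> M"
    using finite_common_bound[OF X(1) J] by metis
  \<comment> \<open>Three errors of size \<open>\<eta>\<close> will occur: from discretizing \<open>\<mu>0\<close>,
    from the oscillation on \<open>A p\<close>, and from \<open>\<delta>\<close>.\<close>
  define \<eta> where "\<eta> = e / 4"
  have \<eta>: "\<eta> > 0" using \<open>e > 0\<close> by (simp add: \<eta>_def)
  obtain s where s: "finite (s ` topspace X)" "s ` topspace X \<subseteq> topspace X"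
    "\<forall>f\<in>J. \<forall>x\<in>topspace X. \<bar>f x - f (s x)\<bar> < \<eta>"
    "\<forall>p\<in>s ` topspace X. {x \<in> topspace X. s x = p} \<in> sets (borel_of X)"
    by (rule finite_retraction_small_oscillation[OF X(1) J \<eta>])
  define B where "B p = {x \<in> topspace X. s x = p}" for p
  define a where "a p = measure \<mu>0 (B p)" for p
  \<comment> \<open>Positive weights allow division by sums of them when a mass is shared among several points.\<close>
  define P where "P = {p \<in> s ` topspace X. a p > 0}"
  have P: "finite P" "P \<subseteq> topspace X" using s by (auto simp: P_def)
  have B: "B p \<in> sets \<mu>0" if "p \<in> s ` topspace X" for p
    using bspec[OF s(4) that] by (simp add: B_def sets0)
  have sum_P: "(\<Sum>p\<in>P. a p * g p) = (\<Sum>p\<in>s ` topspace X. a p * g p)" for g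
    unfolding P_def using s(1) by (intro sum.mono_neutral_left) (auto simp: a_def zero_less_measure_iff)
  have sum_a: "sum a P = 1"
  proof -
    have "disjoint_family_on B (s ` topspace X)" by (auto simp: disjoint_family_on_def B_def)
    then have "sum a (s ` topspace X) = measure \<mu>0 (\<Union>p\<in>s ` topspace X. B p)"
      unfolding a_def using B by (intro finite_measure_finite_Union[symmetric] s(1)) auto
    also have "(\<Union>p\<in>s ` topspace X. B p) = space \<mu>0" by (auto simp: B_def space0)
    finally show ?thesis using sum_P[of "\<lambda>_. 1"] prob_space by simp
  qed
  have upper: "(\<integral>x. f x \<partial>\<mu>0) \<le> (\<Sum>p\<in>P. a p * f p) + \<eta>" if f: "f \<in> J" for f
  proof -
    let ?g = "\<lambda>x. (\<Sum>p\<in>s ` topspace X. f p * indicator (B p) x)"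
    have int: "integrable \<mu>0 (\<lambda>x. f p * indicator (B p) x)" if "p \<in> s ` topspace X" for p
      using B[OF that] by (intro integrable_mult_right integrable_real_indicator) (auto simp: emeasure_eq_measure)
    have "(\<integral>x. f x \<partial>\<mu>0) \<le> (\<integral>x. ?g x + \<eta> \<partial>\<mu>0)"
    proof (rule integral_mono)
      show "integrable \<mu>0 f" by (rule continuous_real_integrable[OF X(1) \<mu>0 J(2)[OF f]])
      show "integrable \<mu>0 (\<lambda>x. ?g x + \<eta>)"
        using int by (intro Bochner_Integration.integrable_add Bochner_Integration.integrable_sum) auto
      fix x assume "x \<in> space \<mu>0"
      then have x: "x \<in> topspace X" by (simp add: space0)
      have "?g x = f (s x) * indicator (B (s x)) x"
        using s(1) x by (subst sum.remove[of _ "s x"]) (auto simp: B_def intro!: sum.neutral)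
      then show "f x \<le> ?g x + \<eta>"
        using bspec[OF bspec[OF s(3) f] x] x by (simp add: B_def abs_less_iff)
    qed
    also have "\<dots> = (\<Sum>p\<in>s ` topspace X. f p * a p) + \<eta>"
      using int B by (simp add: Bochner_Integration.integral_add prob_space Bochner_Integration.integral_sum a_def)
    finally show ?thesis using sum_P[of f] by (simp add: mult.commute)
  qed
  obtain D where D: "\<And>p. p \<in> P \<Longrightarrow> openin X (D p)" "\<And>p. p \<in> P \<Longrightarrow> p \<in> D p" "disjoint_family_on D P"
    using finite_disjoint_neighbourhoods[OF X(2) P] by metis
  have "\<exists>A. closedin X A \<and> p \<in> X interior_of A \<and> A \<subseteq> D p \<and> (\<forall>f\<in>J. \<forall>x\<in>A. f p - \<eta> \<le> f x)" if p: "p \<in> P" for p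
  proof -
    define W where "W = topspace X \<inter> (\<Inter>f\<in>J. {x \<in> topspace X. f x \<in> {f p - \<eta><..}})"
    have "openin X W"
    proof (cases "J = {}")
      case False
      then show ?thesis unfolding W_def using J
        by (intro openin_Int openin_topspace openin_INT2 openin_continuous_map_preimage[of X euclideanreal]) auto
    qed (simp add: W_def)
    then have "openin X (D p \<inter> W)" using D(1)[OF p] by auto
    moreover have "p \<in> D p \<inter> W" using D(2)[OF p] p P(2) \<eta> by (auto simp: W_def)
    ultimately obtain V A where "openin X V" "closedin X A" "p \<in> V" "V \<subseteq> A" "A \<subseteq> D p \<inter> W"
      using closed_neighbourhood[OF X] by metis
    then show ?thesis
      by (intro exI[of _ A]) (auto simp: W_def interior_of_def intro!: less_imp_le)
  qed
  then obtain A where A: "\<And>p. p \<in> P \<Longrightarrow> closedin X (A p)" "\<And>p. p \<in> P \<Longrightarrow> p \<in> X interior_of A p"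
    "\<And>p. p \<in> P \<Longrightarrow> A p \<subseteq> D p" "\<And>p f x. p \<in> P \<Longrightarrow> f \<in> J \<Longrightarrow> x \<in> A p \<Longrightarrow> f p - \<eta> \<le> f x"
    by metis
  have disj: "disjoint_family_on A P"
    using D(3) A(3) unfolding disjoint_family_on_def by blast
  define \<delta> where "\<delta> = \<eta> / (2 * M * (card P + 1))"
  have \<delta>: "\<delta> > 0" "2 * M * (card P * \<delta>) \<le> \<eta>"
  proof -
    have "0 < 2 * M * (card P + 1)" using M(1) by simp
    then show "\<delta> > 0" using \<eta> by (simp add: \<delta>_def)
    have "2 * M * (card P * \<delta>) \<le> 2 * M * (card P + 1) * \<delta>"
      using M(1) \<open>\<delta> > 0\<close> by (simp add: algebra_simps)
    also have "\<dots> = \<eta>" using M(1) by (simp add: \<delta>_def)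
    finally show "2 * M * (card P * \<delta>) \<le> \<eta>" .
  qed
  show thesis
  proof
    show "finite P" "P \<subseteq> topspace X" "sum a P = 1" "\<delta> > 0" by fact+
    show "\<forall>p\<in>P. closedin X (A p) \<and> p \<in> X interior_of A p" using A by blast
    show "\<forall>p\<in>P. a p > 0" by (simp add: P_def)
    show "\<forall>\<mu>\<in>regular_prob_measures X. (\<forall>p\<in>P. a p - \<delta> \<le> measure \<mu> (A p)) \<longrightarrow> \<mu> \<in> \<U>"
    proof (intro ballI impI)
      fix \<mu> assume \<mu>: "\<mu> \<in> regular_prob_measures X" and mass: "\<forall>p\<in>P. a p - \<delta> \<le> measure \<mu> (A p)"
      show "\<mu> \<in> \<U>"
      proof (rule nbhd[OF \<mu>])
        fix f assume f: "f \<in> J"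
        have "(\<Sum>p\<in>P. a p * f p) - \<eta> - 2 * M * (card P * \<delta>) \<le> (\<integral>x. f x \<partial>\<mu>)"
          using A(1) \<eta> \<delta>(1)
          by (intro integral_lower_bound_by_masses[OF X(1) \<mu> J(2)[OF f] M(2)[OF f] P _ disj A(4) _ sum_a bspec[OF mass]])
             (auto intro: closedin_borel_of f)
        then show "(\<integral>x. f x \<partial>\<mu>0) - e < (\<integral>x. f x \<partial>\<mu>)"
          using upper[OF f] \<delta>(2) \<open>e > 0\<close> unfolding \<eta>_def by linarith
      qed
    qed
  qed
qed

text \<open>
  Removing from \<open>Y\<close> the finitely many points of \<open>Q\<close> outside \<open>B\<close> leaves an open superset of \<open>B\<close>
  of the same measure.
\<close>
lemma finitely_supported_measure_regular:
  assumes Y: "compact_space Y" "Hausdorff_space Y" and Q: "finite Q" "Q \<subseteq> topspace Y"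
    and b: "\<And>q. q \<in> Q \<Longrightarrow> 0 \<le> b q" "sum b Q = 1"
  shows "distr (point_measure Q (\<lambda>q. ennreal (b q))) (borel_of Y) (\<lambda>q. q) \<in> regular_prob_measures Y"
    (is "?\<nu> \<in> _")
proof -
  let ?p = "point_measure Q (\<lambda>q. ennreal (b q))"
  have meas: "(\<lambda>q. q) \<in> measurable ?p (borel_of Y)"
    using Q(2) by (auto simp: measurable_def space_point_measure sets_point_measure)
  have "emeasure ?p (space ?p) = 1"
    using b Q(1) by (simp add: space_point_measure emeasure_point_measure_finite sum_ennreal)
  then interpret p: prob_space ?p by (rule prob_spaceI)
  have prob: "prob_space ?\<nu>" using meas by (rule p.prob_space_distr)
  have sets: "sets ?\<nu> = sets (borel_of Y)" by simp
  have emeas: "measure ?\<nu> B = measure ?p (B \<inter> Q)" if "B \<in> sets (borel_of Y)" for B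
    using measure_distr[OF meas that] by (simp add: space_point_measure)
  show ?thesis
  proof (rule regular_prob_measuresI[OF Y(1) prob sets])
    show "\<exists>U. openin Y U \<and> B \<subseteq> U \<and> measure ?\<nu> U \<le> measure ?\<nu> B + e"
      if B: "B \<in> sets ?\<nu>" and "e > 0" for B e
    proof -
      have Bs: "B \<in> sets (borel_of Y)" "B \<subseteq> topspace Y"
        using B sets.sets_into_space[of B "borel_of Y"] by auto
      have "closedin Y (Q - B)"
        using Q Y(2) by (intro closedin_Hausdorff_finite) auto
      then have U: "openin Y (topspace Y - (Q - B))" by auto
      have "(topspace Y - (Q - B)) \<inter> Q = B \<inter> Q" using Q(2) by auto
      then have "measure ?\<nu> (topspace Y - (Q - B)) = measure ?\<nu> B"
        by (simp add: emeas[OF openin_borel_of[OF U]] emeas[OF Bs(1)])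
      then show ?thesis using U Bs(2) \<open>e > 0\<close>
        by (intro exI[of _ "topspace Y - (Q - B)"]) auto
    qed
  qed
qed

text \<open>
  The mass of an open set is not a continuous function of the measure, but it dominates the
  integral of a Urysohn function supported in that set. The discrete measure with masses
  \<open>b q\<close> at \<open>q\<close> shows that the resulting open set is nonempty.
\<close>
lemma mass_condition_contains_open:
  assumes Y: "compact_space Y" "Hausdorff_space Y" and Q: "finite Q" "Q \<subseteq> topspace Y"
    and V: "\<And>q. q \<in> Q \<Longrightarrow> openin Y (V q)" "\<And>q. q \<in> Q \<Longrightarrow> q \<in> V q"
    and b: "\<And>q. q \<in> Q \<Longrightarrow> 0 \<le> b q" "sum b Q = 1" and "\<delta> > 0"
  obtains \<W> where "openin (prob_measures_topology Y) \<W>" "\<W> \<noteq> {}"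
    "\<forall>\<nu>\<in>\<W>. \<forall>q\<in>Q. b q - \<delta> \<le> measure \<nu> (V q)"
proof -
  have "\<exists>h. continuous_map Y euclideanreal h \<and> h q = 1 \<and>
      (\<forall>y\<in>topspace Y. 0 \<le> h y \<and> h y \<le> indicator (V q) y)" if q: "q \<in> Q" for q
  proof -
    have "normal_space Y" using compact_Hausdorff_or_regular_imp_normal_space Y by blast
    moreover have "closedin Y {q}" using q Q Y(2) by (intro closedin_Hausdorff_finite) auto
    moreover have "closedin Y (topspace Y - V q)" using V(1)[OF q] by auto
    moreover have "disjnt (topspace Y - V q) {q}" using V(2)[OF q] by auto
    ultimately obtain h where h: "continuous_map Y (top_of_set {0..1::real}) h"
      "h ` (topspace Y - V q) \<subseteq> {0}" "h ` {q} \<subseteq> {1}"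
      using Urysohn_lemma[of Y "topspace Y - V q" "{q}" 0 1] zero_le_one by metis
    have h01: "h y \<in> {0..1}" if "y \<in> topspace Y" for y
      using h(1) that by (auto simp: continuous_map_def)
    have "0 \<le> h y \<and> h y \<le> indicator (V q) y" if "y \<in> topspace Y" for y
      using h01[OF that] h(2) that by (cases "y \<in> V q") auto
    moreover have "continuous_map Y euclideanreal h"
      using h(1) by (simp add: continuous_map_in_subtopology)
    ultimately show ?thesis using h(3) by auto
  qed
  then have "\<forall>q\<in>Q. \<exists>h. continuous_map Y euclideanreal h \<and> h q = 1 \<and>
      (\<forall>y\<in>topspace Y. 0 \<le> h y \<and> h y \<le> indicator (V q) y)" by blast
  from bchoice[OF this] obtain h where H: "\<forall>q\<in>Q. continuous_map Y euclideanreal (h q) \<and> h q q = 1 \<and>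
      (\<forall>y\<in>topspace Y. 0 \<le> h q y \<and> h q y \<le> indicator (V q) y)" ..
  have h: "continuous_map Y euclideanreal (h q)" "h q q = 1"
    "\<And>y. y \<in> topspace Y \<Longrightarrow> 0 \<le> h q y \<and> h q y \<le> indicator (V q) y" if "q \<in> Q" for q
    using bspec[OF H that] by simp_all
  define N where "N q = {\<nu> \<in> regular_prob_measures Y. (\<integral>y. h q y \<partial>\<nu>) \<in> {b q - \<delta><..}}" for q
  have N: "openin (prob_measures_topology Y) (N q)" if "q \<in> Q" for q
    unfolding prob_measures_topology_def N_def using h(1)[OF that]
    by (intro topology_generated_by_Basis CollectI exI[of _ "h q"] exI[of _ "{b q - \<delta><..}"]) simp
  define \<W> where "\<W> = \<Inter> (N ` Q)"
  have "Q \<noteq> {}" using b(2) by auto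
  have "openin (prob_measures_topology Y) \<W>"
    unfolding \<W>_def using N Q(1) \<open>Q \<noteq> {}\<close> by (intro openin_Inter) auto
  moreover have "\<W> \<noteq> {}"
  proof -
    let ?p = "point_measure Q (\<lambda>q. ennreal (b q))"
    let ?\<nu> = "distr ?p (borel_of Y) (\<lambda>q. q)"
    have \<nu>: "?\<nu> \<in> regular_prob_measures Y"
      by (rule finitely_supported_measure_regular[OF Y Q b])
    have "b q - \<delta> < (\<integral>y. h q y \<partial>?\<nu>)" if q: "q \<in> Q" for q
    proof -
      have "(\<integral>y. h q y \<partial>?\<nu>) = (\<integral>y. h q y \<partial>?p)"
        using continuous_real_borel_measurable[OF h(1)[OF q]] Q(2)
        by (intro integral_distr) (auto simp: measurable_def space_point_measure sets_point_measure)
      also have "\<dots> = (\<Sum>y\<in>Q. b y * h q y)"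
        using Q(1) b(1) by (simp add: lebesgue_integral_point_measure_finite)
      also have "\<dots> \<ge> b q * h q q"
        using q Q b(1) h(3)[OF q] by (intro member_le_sum[of q Q "\<lambda>y. b y * h q y"]) auto
      finally show ?thesis using h(2)[OF q] \<open>\<delta> > 0\<close> by simp
    qed
    then have "?\<nu> \<in> \<W>" using \<nu> by (auto simp: \<W>_def N_def)
    then show ?thesis by blast
  qed
  moreover have "b q - \<delta> \<le> measure \<nu> (V q)" if \<nu>: "\<nu> \<in> \<W>" and q: "q \<in> Q" for \<nu> q
  proof -
    have \<nu>': "\<nu> \<in> regular_prob_measures Y" "b q - \<delta> < (\<integral>y. h q y \<partial>\<nu>)"
      using \<nu> q by (auto simp: \<W>_def N_def)
    interpret prob_space \<nu> using \<nu>'(1) by (rule regular_prob_measuresD)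
    have Vs: "V q \<in> sets \<nu>"
      using openin_borel_of[OF V(1)[OF q]] regular_prob_measuresD(2)[OF \<nu>'(1)] by simp
    have "(\<integral>y. h q y \<partial>\<nu>) \<le> (\<integral>y. indicator (V q) y \<partial>\<nu>)"
      using Vs h(3)[OF q] regular_prob_measuresD(3)[OF \<nu>'(1)]
      by (intro integral_mono continuous_real_integrable[OF Y(1) \<nu>'(1) h(1)[OF q]] integrable_real_indicator)
         (auto simp: emeasure_eq_measure)
    then show ?thesis using \<nu>'(2) Vs by simp
  qed
  ultimately show thesis by (intro that[of \<W>]) auto
qed

section \<open>Semi-open maps induce semi-open maps of measures\<close>

context
  fixes X :: "'x topology" and Y :: "'y topology" and \<phi> :: "'x \<Rightarrow> 'y"
  assumes X: "compact_space X" "Hausdorff_space X"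
    and Y: "compact_space Y" "Hausdorff_space Y"
    and semi_open: "semi_open_map X Y \<phi>"
begin

lemma pushforward_onto:
  "pushforward Y \<phi> ` regular_prob_measures X = regular_prob_measures Y"
proof
  have \<phi>: "continuous_map X Y \<phi>" "\<phi> ` topspace X = topspace Y"
    using semi_open by (auto simp: semi_open_map_def)
  show "pushforward Y \<phi> ` regular_prob_measures X \<subseteq> regular_prob_measures Y"
    using pushforward_regular[OF X Y \<phi>(1)] by blast
  show "regular_prob_measures Y \<subseteq> pushforward Y \<phi> ` regular_prob_measures X"
  proof
    fix \<nu> assume "\<nu> \<in> regular_prob_measures Y"
    then obtain \<mu> where "\<mu> \<in> regular_prob_measures X" "pushforward Y \<phi> \<mu> = \<nu>"
      by (rule lift_measure[OF X Y \<phi>(1), of \<nu> "{()}" "\<lambda>_. topspace X" "\<lambda>_. topspace Y" "\<lambda>_. 1"])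
         (auto simp: \<phi>(2) openin_borel_of)
    then show "\<nu> \<in> pushforward Y \<phi> ` regular_prob_measures X" by blast
  qed
qed

text \<open>
  Discretize a measure in \<open>\<U>\<close> at points \<open>p\<close> with closed neighbourhoods \<open>A p\<close>, and choose
  \<open>y p\<close> in the interior of \<open>\<phi> ` A p\<close>. A measure \<open>\<nu>\<close> with almost the right mass near every
  \<open>y p\<close> is lifted so that the mass near \<open>y p\<close> goes to \<open>A p\<close>; the lift then belongs to \<open>\<U>\<close>.
\<close>
lemma pushforward_image_interior:
  assumes \<U>: "openin (prob_measures_topology X) \<U>" "\<U> \<noteq> {}"
  shows "prob_measures_topology Y interior_of (pushforward Y \<phi> ` \<U>) \<noteq> {}"
proof -
  have \<phi>: "continuous_map X Y \<phi>" "\<phi> ` topspace X = topspace Y"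
    using semi_open by (auto simp: semi_open_map_def)
  obtain \<mu>0 where "\<mu>0 \<in> \<U>" using \<U>(2) by blast
  obtain P A a \<delta> where P: "finite P" "P \<subseteq> topspace X"
    and A: "\<forall>p\<in>P. closedin X (A p) \<and> p \<in> X interior_of A p"
    and a: "\<forall>p\<in>P. a p > (0::real)" "sum a P = 1" "\<delta> > 0"
    and mass: "\<forall>\<mu>\<in>regular_prob_measures X. (\<forall>p\<in>P. a p - \<delta> \<le> measure \<mu> (A p)) \<longrightarrow> \<mu> \<in> \<U>"
    by (rule open_contains_mass_condition[OF X \<U>(1) \<open>\<mu>0 \<in> \<U>\<close>])
  define G where "G p = Y interior_of (\<phi> ` (X interior_of A p))" for p
  have G: "openin Y (G p)" "G p \<subseteq> \<phi> ` A p" for p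
    using interior_of_subset[of Y "\<phi> ` (X interior_of A p)"] interior_of_subset[of X "A p"]
    unfolding G_def by auto
  have "\<exists>z. z \<in> G p" if p: "p \<in> P" for p
  proof -
    have "X interior_of A p \<noteq> {}" using A p by blast
    then have "G p \<noteq> {}"
      using semi_open unfolding semi_open_map_def G_def by simp
    then show ?thesis by blast
  qed
  then obtain y where y: "\<forall>p\<in>P. y p \<in> G p" by metis
  \<comment> \<open>The points \<open>y p\<close> may coincide and cannot always be made distinct, since
    \<open>Y\<close> may have isolated points. The mass at \<open>q\<close> is then shared among the \<open>p\<close>
    over \<open>q\<close> in proportion to \<open>a p\<close>.\<close>
  define Q where "Q = y ` P"
  have Q: "finite Q" "Q \<subseteq> topspace Y"
    using P(1) y openin_subset[OF G(1)] by (auto simp: Q_def)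
  obtain D where D: "\<And>q. q \<in> Q \<Longrightarrow> openin Y (D q)" "\<And>q. q \<in> Q \<Longrightarrow> q \<in> D q" "disjoint_family_on D Q"
    using finite_disjoint_neighbourhoods[OF Y(2) Q] by metis
  define V where "V q = D q \<inter> \<Inter> (G ` {p \<in> P. y p = q})" for q
  have V: "openin Y (V q)" "q \<in> V q" if q: "q \<in> Q" for q
  proof -
    have "{p \<in> P. y p = q} \<noteq> {}" using q by (auto simp: Q_def)
    then show "openin Y (V q)"
      unfolding V_def using D(1)[OF q] G(1) P(1) by (intro openin_Int openin_Inter) auto
    show "q \<in> V q" using D(2)[OF q] y by (auto simp: V_def)
  qed
  have VA: "V (y p) \<subseteq> \<phi> ` A p" if "p \<in> P" for p
    using that G(2)[of p] by (auto simp: V_def)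
  have disj: "V q \<inter> V r = {}" if "q \<in> Q" "r \<in> Q" "q \<noteq> r" for q r
    using D(3) that unfolding disjoint_family_on_def V_def by blast
  define b where "b q = sum a {p \<in> P. y p = q}" for q
  have a_le_b: "a p \<le> b (y p)" if "p \<in> P" for p
    unfolding b_def using P(1) a(1) that by (intro member_le_sum) (auto intro: less_imp_le)
  have b_pos: "0 < b (y p)" if "p \<in> P" for p
    using a_le_b[OF that] a(1) that by fastforce
  have b: "0 \<le> b q" if "q \<in> Q" for q
    using b_pos that by (auto simp: Q_def intro: less_imp_le)
  have sum_b: "sum b Q = 1"
    using sum.image_gen[OF P(1), of a y] a(2) by (simp add: b_def Q_def)
  obtain \<W> where \<W>: "openin (prob_measures_topology Y) \<W>" "\<W> \<noteq> {}"
    "\<forall>\<nu>\<in>\<W>. \<forall>q\<in>Q. b q - \<delta> \<le> measure \<nu> (V q)"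
    by (rule mass_condition_contains_open[OF Y Q V b sum_b a(3)])
  have "\<W> \<subseteq> pushforward Y \<phi> ` \<U>"
  proof
    fix \<nu> assume \<nu>: "\<nu> \<in> \<W>"
    then have reg: "\<nu> \<in> regular_prob_measures Y"
      using openin_subset[OF \<W>(1)] by (auto simp: topspace_prob_measures_topology)
    \<comment> \<open>The index \<open>None\<close> stands for the part of \<open>\<nu>\<close> off the sets \<open>V
      q\<close>, which may be lifted anywhere.\<close>
    define R where "R = topspace Y - \<Union> (V ` Q)"
    define I where "I = insert None (Some ` P)"
    define E where "E i = (case i of None \<Rightarrow> R | Some p \<Rightarrow> V (y p))" for i
    define C where "C i = (case i of None \<Rightarrow> topspace X | Some p \<Rightarrow> A p)" for i
    define c where "c i = (case i of None \<Rightarrow> 1 | Some p \<Rightarrow> a p / b (y p))" for i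
    have "openin Y (\<Union> (V ` Q))" using V(1) by auto
    then have R: "R \<in> sets (borel_of Y)"
      unfolding R_def by (intro closedin_borel_of) auto
    have unity: "(\<Sum>i\<in>I. c i * indicator (E i) z) = 1" if z: "z \<in> topspace Y" for z
    proof -
      have split: "(\<Sum>i\<in>I. c i * indicator (E i) z)
          = indicator R z + (\<Sum>p\<in>P. a p / b (y p) * indicator (V (y p)) z)"
      proof -
        have "sum g I = g None + (\<Sum>p\<in>P. g (Some p))" for g :: "'x option \<Rightarrow> real"
          unfolding I_def using P(1) by (simp add: sum.reindex)
        from this[of "\<lambda>i. c i * indicator (E i) z"] show ?thesis
          unfolding c_def E_def option.case mult_1 .
      qed
      show ?thesis
      proof (cases "\<exists>q\<in>Q. z \<in> V q")
        case True
        then obtain q where q: "q \<in> Q" "z \<in> V q" by blast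
        have ind: "indicator (V (y p)) z = (if y p = q then 1 else 0 :: real)" if "p \<in> P" for p
          using disj[of q "y p"] q that by (auto simp: indicator_def Q_def)
        have "(\<Sum>p\<in>P. a p / b (y p) * indicator (V (y p)) z) = (\<Sum>p\<in>P. if y p = q then a p / b q else 0)"
          by (intro sum.cong refl) (simp add: ind)
        also have "\<dots> = (\<Sum>p\<in>{p\<in>P. y p = q}. a p / b q)"
          using P(1) by (simp add: sum.inter_filter)
        also have "\<dots> = b q / b q" by (simp only: b_def sum_divide_distrib)
        also have "\<dots> = 1"
        proof -
          obtain p where "p \<in> P" "q = y p" using q(1) unfolding Q_def by blast
          then show ?thesis using b_pos[of p] by simp
        qed
        finally have "(\<Sum>p\<in>P. a p / b (y p) * indicator (V (y p)) z) = 1" .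
        moreover have "z \<notin> R" using q by (auto simp: R_def)
        then have "indicator R z = (0::real)" by simp
        ultimately show ?thesis unfolding split by simp
      next
        case False
        then have "(\<Sum>p\<in>P. a p / b (y p) * indicator (V (y p)) z) = 0"
          by (intro sum.neutral) (auto simp: Q_def)
        moreover have "z \<in> R" using False z by (auto simp: R_def)
        then have "indicator R z = (1::real)" by simp
        ultimately show ?thesis unfolding split by simp
      qed
    qed
    have C: "closedin X (C i)" and E: "E i \<in> sets (borel_of Y)" "E i \<subseteq> \<phi> ` C i" and c: "0 \<le> c i"
      if i: "i \<in> I" for i
    proof -
      consider "i = None" | p where "i = Some p" "p \<in> P" using i unfolding I_def by blast
      then have "closedin X (C i) \<and> E i \<in> sets (borel_of Y) \<and> E i \<subseteq> \<phi> ` C i \<and> 0 \<le> c i"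
      proof cases
        case 1
        then show ?thesis using R by (simp add: C_def E_def c_def \<phi>(2)) (simp add: R_def)
      next
        case (2 p)
        then have "y p \<in> Q" by (simp add: Q_def)
        then show ?thesis
          using 2 A VA[OF 2(2)] openin_borel_of[OF V(1)] a(1) b_pos[OF 2(2)]
          by (simp add: C_def E_def c_def less_imp_le)
      qed
      then show "closedin X (C i)" "E i \<in> sets (borel_of Y)" "E i \<subseteq> \<phi> ` C i" "0 \<le> c i" by auto
    qed
    have "finite I" using P(1) by (simp add: I_def)
    obtain \<mu> where \<mu>: "\<mu> \<in> regular_prob_measures X" "pushforward Y \<phi> \<mu> = \<nu>"
      "\<forall>i\<in>I. c i * measure \<nu> (E i) \<le> measure \<mu> (C i)"
      by (rule lift_measure[OF X Y \<phi>(1) reg \<open>finite I\<close> C E c unity])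
    have "a p - \<delta> \<le> measure \<mu> (A p)" if p: "p \<in> P" for p
    proof -
      have q: "y p \<in> Q" using p by (simp add: Q_def)
      have ab: "0 \<le> a p / b (y p)" "a p / b (y p) \<le> 1"
        using a(1) p b_pos[OF p] a_le_b[OF p] by (auto simp: less_imp_le)
      have "a p - \<delta> \<le> a p - (a p / b (y p)) * \<delta>"
        using mult_right_mono[OF ab(2), of \<delta>] a(3) by simp
      also have "\<dots> = (a p / b (y p)) * (b (y p) - \<delta>)"
        using b_pos[OF p] by (simp add: field_simps)
      also have "\<dots> \<le> (a p / b (y p)) * measure \<nu> (V (y p))"
        using \<W>(3) \<nu> q ab(1) by (intro mult_left_mono) auto
      also have "\<dots> \<le> measure \<mu> (A p)"
        using \<mu>(3) p by (auto simp: I_def c_def E_def C_def)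
      finally show ?thesis .
    qed
    then have "\<mu> \<in> \<U>" using mass \<mu>(1) by blast
    then show "\<nu> \<in> pushforward Y \<phi> ` \<U>" using \<mu>(2) by blast
  qed
  then show ?thesis
    using \<W>(1,2) interior_of_maximal[of \<W> "pushforward Y \<phi> ` \<U>" "prob_measures_topology Y"] by blast
qed

theorem semi_open_pushforward:
  "semi_open_map (prob_measures_topology X) (prob_measures_topology Y) (pushforward Y \<phi>)"
  unfolding semi_open_map_def topspace_prob_measures_topology
  using continuous_map_pushforward[OF X Y] pushforward_onto pushforward_image_interior semi_open
  by (auto simp: semi_open_map_def)

end

theorem theorem1p3p4:
  fixes S :: "('s, 'm) monoid_scheme"
    and X :: "'x topology" and actX :: "'s \<Rightarrow> 'x \<Rightarrow> 'x"
    and Y :: "'y topology" and actY :: "'s \<Rightarrow> 'y \<Rightarrow> 'y"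
    and \<phi> :: "'x \<Rightarrow> 'y"
  assumes "minimal_flow S X actX"
    and "minimal_flow S Y actY"
    and "flow_extension S X actX Y actY \<phi>"
  shows "semi_open_map (prob_measures_topology X) (prob_measures_topology Y)
           (pushforward Y \<phi>)"
proof -
  interpret flow_extension S X actX Y actY \<phi> by fact
  show ?thesis
    using X.compact X.Hausdorff Y.compact Y.Hausdorff minimal_extension_semi_open[OF assms(1,3)]
    by (rule semi_open_pushforward)
qed

end
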